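(* Let $n\geq 1$, let $\alpha\in\mathbb{Z}_{\geq 0}^n$ be a composition, and let $\kappa_\alpha(x)$ be its key polynomial. For every vector $\beta\in\mathbb{Z}_{\geq 0}^n$, $\beta$ is a lattice point in $\mathrm{Newton}(\kappa_\alpha)$ if and only if $\beta\leq_\kappa\alpha$. Equivalently, $\beta$ is an exponent vector of $\kappa_\alpha(x)$ if and only if $\beta\leq_\kappa\alpha$.
   Context: A composition is a vector $\alpha=(\alpha_1,\ldots,\alpha_n)\in\mathbb{Z}_{\geq 0}^n$. Key polynomials: for $1\le i\le n-1$ and a polynomial $f\in\mathbb{Z}[x_1,\ldots,x_n]$, let $s_if$ be obtained from $f$ by exchanging $x_i$ and $x_{i+1}$, let $\partial_i(f)=\frac{f-s_if}{x_i-x_{i+1}}$, and let $\pi_i(f)=\partial_i(x_if)$. If $\alpha$ is weakly decreasing ($\alpha_1\geq\cdots\geq\alpha_n$), set $\kappa_\alpha(x)=x^\alpha=x_1^{\alpha_1}\cdots x_n^{\alpha_n}$. Otherwise choose $i$ with $\alpha_i<\alpha_{i+1}$, let $\alpha'$ be obtained from $\alpha$ by interchanging $\alpha_i$ and $\alpha_{i+1}$, and set $\kappa_\alpha(x)=\pi_i(\kappa_{\alpha'}(x))$; this is independent of the choice of $i$. For $f=\sum_{\gamma\in\mathbb{Z}_{\geq 0}^n}c_\gamma x^\gamma\in\mathbb{R}[x_1,\ldots,x_n]$, an exponent vector of $f$ is a $\gamma$ with $c_\gamma\neq 0$, and the Newton polytope $\mathrm{Newton}(f)\subseteq\mathbb{R}^n$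 is the convex hull of the exponent vectors of $f$. A lattice point is a point with integer coordinates. For $1\leq i<j\leq n$ and a composition $\gamma$, let $t_{i,j}(\gamma)$ be obtained from $\gamma$ by interchanging $\gamma_i$ and $\gamma_j$, and let $m_{i,j}(\gamma)=\gamma+e_i-e_j$, where $e_k$ is the $k$-th standard coordinate vector. Define $\beta\leq_\kappa\alpha$ if $\beta$ can be obtained from $\alpha$ by a finite (possibly empty) sequence of moves, each of which replaces the current composition $\gamma$ either by $t_{i,j}(\gamma)$ for some $i<j$ with $\gamma_i<\gamma_j$, or by $m_{i,j}(\gamma)$ for some $i<j$ with $\gamma_i<\gamma_j-1$. *)

theory Defs
  imports "HOL-Analysis.Analysis" "HOL-Analysis.Finite_Function_Topology"
    "HOL-Combinatorics.Transposition"
begin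

text \<open>
  Vectors indexed by \<open>1, ..., n\<close> are finitely supported functions on \<open>nat\<close> whose support lies in
  \<open>{1..n}\<close>, and \<open>\<int>[x\<^sub>1, ..., x\<^sub>n]\<close> is embedded in the ring \<open>(nat \<Rightarrow>\<^sub>0 nat) \<Rightarrow>\<^sub>0 int\<close> of polynomials in
  countably many variables, a polynomial being the finitely supported function taking an exponent
  vector to its coefficient. Likewise \<open>\<real>\<^sup>n\<close> is the subspace of vectors in \<open>nat \<Rightarrow>\<^sub>0 real\<close> supported
  in \<open>{1..n}\<close>.
\<close>

type_synonym expvec = "nat \<Rightarrow>\<^sub>0 nat"

definition composition :: "nat \<Rightarrow> expvec \<Rightarrow> bool" where
  "composition n \<alpha> \<longleftrightarrow> Poly_Mapping.keys \<alpha> \<subseteq> {1..n}"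

definition interchange :: "nat \<Rightarrow> nat \<Rightarrow> expvec \<Rightarrow> expvec" where
  "interchange i j \<gamma> = Poly_Mapping.map_key (Transposition.transpose i j) \<gamma>"

lemma lookup_interchange:
  "Poly_Mapping.lookup (interchange i j \<gamma>) k = Poly_Mapping.lookup \<gamma> (Transposition.transpose i j k)"
  by (simp add: interchange_def map_key.rep_eq)

lemma interchange_interchange [simp]: "interchange i j (interchange i j \<gamma>) = \<gamma>"
  by (rule poly_mapping_eqI) (simp add: lookup_interchange)

lemma inj_interchange: "inj (interchange i j)"
  by (metis injI interchange_interchange)


section \<open>Key polynomials\<close>

definition monomial :: "expvec \<Rightarrow> expvec \<Rightarrow>\<^sub>0 int" where
  "monomial \<gamma> = Poly_Mapping.single \<gamma> 1"

definition var :: "nat \<Rightarrow> expvec \<Rightarrow>\<^sub>0 int" where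
  "var i = monomial (Poly_Mapping.single i 1)"

text \<open>The coefficient of \<open>x\<^sup>\<gamma>\<close> in \<open>s\<^sub>i f\<close> is the coefficient in \<open>f\<close> of \<open>x\<close> to the power \<open>\<gamma>\<close> with its
  entries \<open>i\<close> and \<open>i + 1\<close> interchanged.\<close>

definition swap_vars :: "nat \<Rightarrow> (expvec \<Rightarrow>\<^sub>0 int) \<Rightarrow> expvec \<Rightarrow>\<^sub>0 int" where
  "swap_vars i f = Poly_Mapping.map_key (interchange i (i + 1)) f"

text \<open>The quotient \<open>(f - s\<^sub>i f) / (x\<^sub>i - x\<^sub>i\<^sub>+\<^sub>1)\<close> is the unique polynomial solution \<open>g\<close> below; see
  \<open>divided_difference_mult\<close> for existence.\<close>

definition divided_difference :: "nat \<Rightarrow> (expvec \<Rightarrow>\<^sub>0 int) \<Rightarrow> expvec \<Rightarrow>\<^sub>0 int" where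
  "divided_difference i f = (THE g. (var i - var (i + 1)) * g = f - swap_vars i f)"

lemma swap_vars_add: "swap_vars i (f + g) = swap_vars i f + swap_vars i g"
  by (simp add: swap_vars_def map_key_plus inj_interchange)

lemma swap_vars_single:
  "swap_vars i (Poly_Mapping.single \<gamma> c) = Poly_Mapping.single (interchange i (i + 1) \<gamma>) c"
  unfolding swap_vars_def
  by (metis inj_interchange interchange_interchange map_key_single)

lemma single_eq_var_powers:
  "Poly_Mapping.single (\<delta> + Poly_Mapping.single i a + Poly_Mapping.single j b) c
    = Poly_Mapping.single \<delta> c * (var i ^ a * var j ^ b)"
proof -
  have "var k ^ m = Poly_Mapping.single (Poly_Mapping.single k m) 1" for k m
    by (induction m) (auto simp: var_def monomial_def mult_single single_add[symmetric] single_one)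
  then show ?thesis
    by (simp add: mult_single add.assoc)
qed

lemma diff_dvd_swapped_powers:
  fixes x y :: "'a::comm_ring_1"
  shows "(x - y) dvd (x ^ a * y ^ b - x ^ b * y ^ a)"
proof -
  have *: "(x - y) dvd (x ^ (a + k) * y ^ a - x ^ a * y ^ (a + k))" for a k
  proof -
    have "(x - y) dvd (x ^ k - y ^ k)"
      by (metis dvd_triv_left power_diff_sumr2)
    moreover have "x ^ (a + k) * y ^ a - x ^ a * y ^ (a + k) = (x ^ k - y ^ k) * (x ^ a * y ^ a)"
      by (simp add: algebra_simps power_add)
    ultimately show ?thesis by simp
  qed
  show ?thesis
  proof (cases "b \<le> a")
    case True
    then show ?thesis using *[of b "a - b"] by simp
  next
    case False
    then have "(x - y) dvd (x ^ b * y ^ a - x ^ a * y ^ b)"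
      using *[of a "b - a"] by simp
    then show ?thesis by (metis dvd_minus_iff minus_diff_eq)
  qed
qed

lemma divided_difference_dvd: "(var i - var (i + 1)) dvd (f - swap_vars i f)"
proof -
  have single: "(var i - var (i + 1)) dvd
      (Poly_Mapping.single \<gamma> c - swap_vars i (Poly_Mapping.single \<gamma> c))" for \<gamma> c
  proof -
    define a b where "a = Poly_Mapping.lookup \<gamma> i" and "b = Poly_Mapping.lookup \<gamma> (i + 1)"
    define \<delta> where "\<delta> = \<gamma> - (Poly_Mapping.single i a + Poly_Mapping.single (i + 1) b)"
    have \<gamma>: "\<gamma> = \<delta> + Poly_Mapping.single i a + Poly_Mapping.single (i + 1) b"
      by (rule poly_mapping_eqI)
        (auto simp: \<delta>_def a_def b_def lookup_add lookup_minus lookup_single when_def)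
    have s\<gamma>: "interchange i (i + 1) \<gamma> = \<delta> + Poly_Mapping.single i b + Poly_Mapping.single (i + 1) a"
      by (rule poly_mapping_eqI)
        (auto simp: \<delta>_def a_def b_def lookup_add lookup_minus lookup_single when_def
          lookup_interchange Transposition.transpose_def)
    have "Poly_Mapping.single \<gamma> c - swap_vars i (Poly_Mapping.single \<gamma> c) = Poly_Mapping.single \<delta> c *
        (var i ^ a * var (i + 1) ^ b - var i ^ b * var (i + 1) ^ a)"
      unfolding swap_vars_single s\<gamma>
      by (subst \<gamma>) (simp only: single_eq_var_powers right_diff_distrib)
    then show ?thesis
      using diff_dvd_swapped_powers[of "var i" "var (i + 1)" a b] by simp
  qed
  show ?thesis
  proof (induction f rule: update_induct)
    case const
    show ?case by (simp add: swap_vars_def inj_interchange)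
  next
    case (update f \<gamma> c)
    have "Poly_Mapping.update \<gamma> c f = f + Poly_Mapping.single \<gamma> c"
      using update by (intro poly_mapping_eqI)
        (auto simp: lookup_update lookup_add lookup_single in_keys_iff when_def)
    then show ?case
      using dvd_add[OF update(3) single[of \<gamma> c]] by (simp add: swap_vars_add algebra_simps)
  qed
qed

lemma var_neq: "i \<noteq> j \<Longrightarrow> var i \<noteq> var j"
  by (metis lookup_single_eq lookup_single_not_eq monomial_def one_neq_zero var_def)

lemma divided_difference_mult:
  "(var i - var (i + 1)) * divided_difference i f = f - swap_vars i f"
proof -
  have "\<exists>!g. (var i - var (i + 1)) * g = f - swap_vars i f"
  proof (rule ex_ex1I)
    show "\<exists>g. (var i - var (i + 1)) * g = f - swap_vars i f"
      using divided_difference_dvd[of i f] by (auto elim: dvdE)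
    show "g = h" if "(var i - var (i + 1)) * g = f - swap_vars i f"
      "(var i - var (i + 1)) * h = f - swap_vars i f" for g h
    proof -
      have "(var i - var (i + 1)) * g = (var i - var (i + 1)) * h"
        using that by simp
      moreover have "var i - var (i + 1) \<noteq> 0"
        using var_neq[of i "i + 1"] by simp
      ultimately show ?thesis by (metis mult_left_cancel)
    qed
  qed
  then show ?thesis
    unfolding divided_difference_def by (rule theI')
qed

definition demazure :: "nat \<Rightarrow> (expvec \<Rightarrow>\<^sub>0 int) \<Rightarrow> expvec \<Rightarrow>\<^sub>0 int" where
  "demazure i f = divided_difference i (var i * f)"

definition weakly_decreasing :: "nat \<Rightarrow> expvec \<Rightarrow> bool" where
  "weakly_decreasing n \<alpha> \<longleftrightarrow>
    (\<forall>i\<in>{1..<n}. Poly_Mapping.lookup \<alpha> i \<ge> Poly_Mapping.lookup \<alpha> (i + 1))"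

definition is_ascent :: "nat \<Rightarrow> expvec \<Rightarrow> nat \<Rightarrow> bool" where
  "is_ascent n \<alpha> i \<longleftrightarrow> i \<in> {1..<n} \<and> Poly_Mapping.lookup \<alpha> i < Poly_Mapping.lookup \<alpha> (i + 1)"

lemma ex_ascent: "\<not> weakly_decreasing n \<alpha> \<Longrightarrow> \<exists>i. is_ascent n \<alpha> i"
  by (auto simp: weakly_decreasing_def is_ascent_def not_le)

lemma interchange_weight_less:
  assumes "is_ascent n \<alpha> i"
  shows "(\<Sum>k=1..n. k * Poly_Mapping.lookup (interchange i (i + 1) \<alpha>) k)
    < (\<Sum>k=1..n. k * Poly_Mapping.lookup \<alpha> k)"
proof -
  let ?a = "Poly_Mapping.lookup \<alpha>"
  have i: "i \<in> {1..n}" "i + 1 \<in> {1..n} - {i}" and lt: "?a i < ?a (i + 1)"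
    using assms by (auto simp: is_ascent_def)
  have split: "(\<Sum>k=1..n. k * f k) = i * f i + ((i + 1) * f (i + 1) + (\<Sum>k\<in>{1..n} - {i} - {i + 1}. k * f k))"
    for f :: "nat \<Rightarrow> nat"
    using i by (subst sum.remove[of _ i], simp, simp, subst sum.remove[of _ "i + 1"]) auto
  have rest: "(\<Sum>k\<in>{1..n} - {i} - {i + 1}. k * Poly_Mapping.lookup (interchange i (i + 1) \<alpha>) k)
      = (\<Sum>k\<in>{1..n} - {i} - {i + 1}. k * ?a k)"
    by (rule sum.cong) (auto simp: lookup_interchange Transposition.transpose_def)
  show ?thesis
    unfolding split[of "Poly_Mapping.lookup (interchange i (i + 1) \<alpha>)"] split[of ?a] rest
    using lt by (simp add: lookup_interchange algebra_simps)
qed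

text \<open>The definition leaves the choice of the ascent \<open>i\<close> open; it does not affect the result.\<close>

function key_poly :: "nat \<Rightarrow> expvec \<Rightarrow> expvec \<Rightarrow>\<^sub>0 int" where
  "key_poly n \<alpha> =
    (if weakly_decreasing n \<alpha> then monomial \<alpha>
     else let i = (SOME i. is_ascent n \<alpha> i)
          in demazure i (key_poly n (interchange i (i + 1) \<alpha>)))"
  by pat_completeness auto
termination
proof (relation "Wellfounded.measure (\<lambda>(n, \<alpha>). \<Sum>k=1..n. k * Poly_Mapping.lookup \<alpha> k)")
  fix n \<alpha> i
  assume "\<not> weakly_decreasing n \<alpha>" "i = (SOME i. is_ascent n \<alpha> i)"
  then have "is_ascent n \<alpha> i"
    using someI_ex[OF ex_ascent] by simp
  then show "((n, interchange i (i + 1) \<alpha>), n, \<alpha>)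
      \<in> Wellfounded.measure (\<lambda>(n, \<alpha>). \<Sum>k=1..n. k * Poly_Mapping.lookup \<alpha> k)"
    using interchange_weight_less by simp
qed simp

declare key_poly.simps [simp del]


section \<open>Newton polytopes\<close>

text \<open>The exponent vectors of \<open>f\<close> are \<open>Poly_Mapping.keys f\<close>.\<close>

definition real_vec :: "expvec \<Rightarrow> nat \<Rightarrow>\<^sub>0 real" where
  "real_vec \<gamma> = Poly_Mapping.map real \<gamma>"

definition newton :: "(expvec \<Rightarrow>\<^sub>0 'a::zero) \<Rightarrow> (nat \<Rightarrow>\<^sub>0 real) set" where
  "newton f = convex hull (real_vec ` Poly_Mapping.keys f)"

definition lattice_point :: "(nat \<Rightarrow>\<^sub>0 real) \<Rightarrow> bool" where
  "lattice_point v \<longleftrightarrow> (\<forall>i. Poly_Mapping.lookup v i \<in> \<int>)"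


section \<open>The order on compositions\<close>

text \<open>In \<open>move\<close> the truncated subtraction on \<open>nat\<close> is exact, since \<open>\<gamma>\<^sub>j > 0\<close>.\<close>

inductive kappa_step :: "nat \<Rightarrow> expvec \<Rightarrow> expvec \<Rightarrow> bool" for n :: nat where
  interchange: "\<lbrakk>1 \<le> i; i < j; j \<le> n; Poly_Mapping.lookup \<gamma> i < Poly_Mapping.lookup \<gamma> j\<rbrakk>
    \<Longrightarrow> kappa_step n \<gamma> (interchange i j \<gamma>)"
| move: "\<lbrakk>1 \<le> i; i < j; j \<le> n; Poly_Mapping.lookup \<gamma> i + 1 < Poly_Mapping.lookup \<gamma> j\<rbrakk>
    \<Longrightarrow> kappa_step n \<gamma> (\<gamma> + Poly_Mapping.single i 1 - Poly_Mapping.single j 1)"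

definition kappa_le :: "nat \<Rightarrow> expvec \<Rightarrow> expvec \<Rightarrow> bool" where
  "kappa_le n \<beta> \<alpha> \<longleftrightarrow> (kappa_step n)\<^sup>*\<^sup>* \<alpha> \<beta>"

end

theory Submission
  imports Defs
begin

text \<open>
  Let \<open>K\<close> be the set of compositions below \<open>\<alpha>\<close> and let \<open>P\<close> be the set of lattice vectors \<open>\<beta>\<close> of the
  same size as \<open>\<alpha>\<close> with \<open>\<beta>(I) \<le> \<theta>(I)\<close> for all \<open>I \<subseteq> {1..n}\<close>, where \<open>\<theta>\<close> is the sum of the rank
  functions of the Schubert matroids of the columns of the diagram of \<open>\<alpha>\<close>. As \<open>P\<close> is cut out by
  linear inequalities, it suffices to show \<open>supp \<kappa>\<^sub>\<alpha> \<subseteq> K \<subseteq> P \<subseteq> supp \<kappa>\<^sub>\<alpha>\<close>.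

  The first inclusion holds because \<open>K\<close> is closed under the strings produced by \<open>\<pi>\<^sub>i\<close>, the second
  because \<open>\<theta>\<close> does not increase along moves. The third needs that nothing cancels. If
  \<open>\<alpha>\<^sub>1 \<ge> \<dots> \<ge> \<alpha>\<^sub>n\<^sub>-\<^sub>1\<close>, then \<open>\<kappa>\<^sub>\<alpha>\<close> is an explicit multiplicity-free sum of monomials, which can be
  regrouped into key polynomials in \<open>x\<^sub>1, \<dots>, x\<^sub>n\<^sub>-\<^sub>1\<close> times powers of \<open>x\<^sub>n\<close>. For \<open>i \<le> n - 2\<close> the
  operator \<open>\<pi>\<^sub>i\<close> maps key polynomials in \<open>x\<^sub>1, \<dots>, x\<^sub>n\<^sub>-\<^sub>1\<close> to key polynomials, so every \<open>\<kappa>\<^sub>\<alpha>\<close> is such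
  a sum. Hence coefficients are nonnegative, and the support can be computed by induction on \<open>n\<close>.

  Entries outside \<open>{1..n}\<close> are unaffected by \<open>key_poly n\<close>, so \<open>key_poly n \<alpha>\<close> also stands for a key
  polynomial in \<open>x\<^sub>1, \<dots>, x\<^sub>n\<close> times a monomial in the remaining variables.
\<close>

abbreviation entry :: "expvec \<Rightarrow> nat \<Rightarrow> nat" where
  "entry \<equiv> Poly_Mapping.lookup"

abbreviation coef :: "(expvec \<Rightarrow>\<^sub>0 int) \<Rightarrow> expvec \<Rightarrow> int" where
  "coef \<equiv> Poly_Mapping.lookup"

abbreviation adj :: "nat \<Rightarrow> expvec \<Rightarrow> expvec" where
  "adj i \<equiv> interchange i (Suc i)"

section \<open>Demazure operators\<close>

lemma coef_swap_vars: "coef (swap_vars i f) \<gamma> = coef f (adj i \<gamma>)"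
  by (simp add: swap_vars_def map_key.rep_eq inj_interchange)

lemma poly_add_induct [case_names single add]:
  fixes f :: "'a \<Rightarrow>\<^sub>0 'b::comm_monoid_add"
  assumes "\<And>\<gamma> c. P (Poly_Mapping.single \<gamma> c)" "\<And>f g. P f \<Longrightarrow> P g \<Longrightarrow> P (f + g)"
  shows "P f"
proof (induction f rule: update_induct)
  case const
  show ?case using assms(1)[of undefined 0] by simp
next
  case (update f \<gamma> c)
  have "Poly_Mapping.update \<gamma> c f = f + Poly_Mapping.single \<gamma> c"
    using update by (intro poly_mapping_eqI)
      (auto simp: lookup_update lookup_add lookup_single in_keys_iff when_def)
  then show ?case using assms update by simp
qed

lemma interchange_add: "interchange i j (\<gamma> + \<delta>) = interchange i j \<gamma> + interchange i j \<delta>"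
  by (rule poly_mapping_eqI) (simp add: lookup_interchange lookup_add)

lemma swap_vars_mult: "swap_vars i (f * g) = swap_vars i f * swap_vars i g"
proof (induction f rule: poly_add_induct)
  case (single \<gamma> c)
  show ?case
  proof (induction g rule: poly_add_induct)
    case (single \<delta> d)
    show ?case by (simp only: mult_single swap_vars_single interchange_add)
  next
    case (add g h)
    then show ?case by (simp add: distrib_left swap_vars_add)
  qed
next
  case (add f h)
  then show ?case by (simp add: distrib_right swap_vars_add)
qed

lemma swap_vars_zero [simp]: "swap_vars i 0 = 0"
  by (rule poly_mapping_eqI) (simp add: coef_swap_vars)

lemma swap_vars_diff: "swap_vars i (f - g) = swap_vars i f - swap_vars i g"
  by (rule poly_mapping_eqI) (simp add: coef_swap_vars lookup_minus)

lemma swap_vars_swap_vars [simp]: "swap_vars i (swap_vars i f) = f"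
  by (rule poly_mapping_eqI) (simp add: coef_swap_vars)

lemma interchange_single:
  "interchange i j (Poly_Mapping.single k c) = Poly_Mapping.single (Transposition.transpose i j k) c"
  by (rule poly_mapping_eqI)
    (auto simp: lookup_interchange lookup_single when_def transpose_eq_iff)

lemma swap_vars_var: "swap_vars i (var k) = var (Transposition.transpose i (Suc i) k)"
  by (simp add: var_def monomial_def swap_vars_single interchange_single)

lemma swap_vars_var_simps [simp]:
  "swap_vars i (var i) = var (Suc i)" "swap_vars i (var (Suc i)) = var i"
  "k \<noteq> i \<Longrightarrow> k \<noteq> Suc i \<Longrightarrow> swap_vars i (var k) = var k"
  by (simp_all add: swap_vars_var Transposition.transpose_def)

lemma var_diff_nonzero: "i \<noteq> j \<Longrightarrow> var i - var j \<noteq> 0"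
  using var_neq by simp

lemma demazure_mult:
  "(var i - var (Suc i)) * demazure i f = var i * f - var (Suc i) * swap_vars i f"
  using divided_difference_mult[of i "var i * f"]
  by (simp add: demazure_def swap_vars_mult)

text \<open>The polynomial ring has no zero divisors, so a candidate for \<open>demazure i f\<close>
  can be checked after clearing the denominator.\<close>

lemma demazure_unique:
  assumes "(var i - var (Suc i)) * g = var i * f - var (Suc i) * swap_vars i f"
  shows "demazure i f = g"
proof -
  have "(var i - var (Suc i)) * demazure i f = (var i - var (Suc i)) * g"
    using assms by (simp add: demazure_mult)
  then show ?thesis using var_diff_nonzero[of i "Suc i"] by simp
qed

lemma demazure_add: "demazure i (f + g) = demazure i f + demazure i g"
  by (rule demazure_unique) (simp add: distrib_left demazure_mult swap_vars_add)

lemma demazure_zero [simp]: "demazure i 0 = 0"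
  by (rule demazure_unique) simp

lemma demazure_sum: "demazure i (\<Sum>x\<in>X. f x) = (\<Sum>x\<in>X. demazure i (f x))"
  by (induction X rule: infinite_finite_induct) (simp_all add: demazure_add)

lemma demazure_symmetric:
  assumes "swap_vars i f = f"
  shows "demazure i f = f"
  by (rule demazure_unique) (simp add: assms left_diff_distrib)

text \<open>Numerator and denominator in \<open>demazure_mult\<close> both change sign under
  \<open>swap_vars i\<close>, so the quotient is symmetric.\<close>

lemma swap_vars_demazure: "swap_vars i (demazure i f) = demazure i f"
proof -
  have "(var (Suc i) - var i) * swap_vars i (demazure i f)
      = swap_vars i ((var i - var (Suc i)) * demazure i f)"
    by (simp add: swap_vars_mult swap_vars_diff)
  also have "\<dots> = - (var i * f - var (Suc i) * swap_vars i f)"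
    unfolding demazure_mult by (simp add: swap_vars_mult swap_vars_diff)
  also have "\<dots> = (var (Suc i) - var i) * demazure i f"
    unfolding demazure_mult[symmetric] by (simp add: left_diff_distrib)
  finally show ?thesis using var_diff_nonzero[of "Suc i" i] by simp
qed

lemma demazure_idem [simp]: "demazure i (demazure i f) = demazure i f"
  by (simp add: demazure_symmetric swap_vars_demazure)

lemma swap_vars_commute:
  assumes "Suc i < j \<or> Suc j < i"
  shows "swap_vars i (swap_vars j f) = swap_vars j (swap_vars i f)"
proof (rule poly_mapping_eqI)
  fix \<gamma>
  have "adj j (adj i \<gamma>) = adj i (adj j \<gamma>)"
    using assms by (intro poly_mapping_eqI)
      (auto simp: lookup_interchange Transposition.transpose_def)
  then show "coef (swap_vars i (swap_vars j f)) \<gamma> = coef (swap_vars j (swap_vars i f)) \<gamma>"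
    by (simp add: coef_swap_vars)
qed

lemma swap_vars_braid:
  "swap_vars i (swap_vars (Suc i) (swap_vars i f))
    = swap_vars (Suc i) (swap_vars i (swap_vars (Suc i) f))"
proof (rule poly_mapping_eqI)
  fix \<gamma>
  have "adj i (adj (Suc i) (adj i \<gamma>)) = adj (Suc i) (adj i (adj (Suc i) \<gamma>))"
    by (intro poly_mapping_eqI) (auto simp: lookup_interchange Transposition.transpose_def)
  then show "coef (swap_vars i (swap_vars (Suc i) (swap_vars i f))) \<gamma>
      = coef (swap_vars (Suc i) (swap_vars i (swap_vars (Suc i) f))) \<gamma>"
    by (simp add: coef_swap_vars)
qed

lemma swap_vars_demazure_commute:
  assumes "Suc i < j \<or> Suc j < i"
  shows "swap_vars j (demazure i f) = demazure i (swap_vars j f)"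
proof (rule demazure_unique[symmetric])
  have "(var i - var (Suc i)) * swap_vars j (demazure i f)
      = swap_vars j ((var i - var (Suc i)) * demazure i f)"
    using assms by (auto simp: swap_vars_mult swap_vars_diff)
  also have "\<dots> = var i * swap_vars j f - var (Suc i) * swap_vars i (swap_vars j f)"
    unfolding demazure_mult using assms swap_vars_commute[of i j f]
    by (auto simp: swap_vars_mult swap_vars_diff)
  finally show "(var i - var (Suc i)) * swap_vars j (demazure i f)
      = var i * swap_vars j f - var (Suc i) * swap_vars i (swap_vars j f)" .
qed

text \<open>For distant indices each swap fixes the variables of the other denominator, so both
  sides agree once both denominators are cleared.\<close>

lemma demazure_commute:
  assumes "Suc i < j \<or> Suc j < i"
  shows "demazure i (demazure j f) = demazure j (demazure i f)"
proof (rule demazure_unique)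
  let ?A = "var i - var (Suc i)" and ?B = "var j - var (Suc j)"
  let ?R = "var i * demazure j f - var (Suc i) * swap_vars i (demazure j f)"
  have s: "swap_vars i (demazure j f) = demazure j (swap_vars i f)"
    using assms swap_vars_demazure_commute[of j i f] by auto
  have s': "swap_vars j (demazure i f) = demazure i (swap_vars j f)"
    using assms swap_vars_demazure_commute[of i j f] by auto
  have "?B * (?A * demazure j (demazure i f))
      = ?A * (var j * demazure i f - var (Suc j) * swap_vars j (demazure i f))"
    by (simp add: demazure_mult[of j "demazure i f", symmetric] ac_simps)
  also have "\<dots> = var j * (?A * demazure i f) - var (Suc j) * (?A * demazure i (swap_vars j f))"
    unfolding s' by (simp add: algebra_simps)
  also have "\<dots> = var i * (?B * demazure j f) - var (Suc i) * (?B * demazure j (swap_vars i f))"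
    unfolding demazure_mult swap_vars_commute[OF assms] by (simp add: algebra_simps)
  also have "\<dots> = ?B * ?R"
    unfolding s by (simp add: algebra_simps)
  finally show "?A * demazure j (demazure i f) = ?R"
    using var_diff_nonzero[of j "Suc j"] by simp
qed

text \<open>Multiplied by the Vandermonde determinant, both sides become the antisymmetrisation of
  \<open>x\<^sub>i\<^sup>2 x\<^sub>i\<^sub>+\<^sub>1 f\<close>.\<close>

lemma demazure_braid:
  "demazure i (demazure (Suc i) (demazure i f))
    = demazure (Suc i) (demazure i (demazure (Suc i) f))"
proof -
  define x y z where "x = var i" and "y = var (Suc i)" and "z = var (Suc (Suc i))"
  define s t where "s = swap_vars i" and "t = swap_vars (Suc i)"
  define V where "V = (x - y) * (y - z) * (x - z)"
  define R where "R = x*x*y*f - x*x*z* t f - x*y*y* s f + y*y*z* s (t f) + x*z*z* t (s f)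
    - y*z*z* t (s (t f))"
  have hom: "s (p * q) = s p * s q" "s (p - q) = s p - s q" "s (s p) = p"
    "t (p * q) = t p * t q" "t (p - q) = t p - t q" "t (t p) = p" "s (t (s p)) = t (s (t p))" for p q
    by (simp_all add: s_def t_def swap_vars_mult swap_vars_diff swap_vars_braid)
  have sv: "s x = y" "s y = x" "s z = z" "t x = x" "t y = z" "t z = y"
    by (simp_all add: s_def t_def x_def y_def z_def)
  have di: "(x - y) * demazure i p = x * p - y * s p" for p
    using demazure_mult by (simp add: x_def y_def s_def)
  have dj: "(y - z) * demazure (Suc i) p = y * p - z * t p" for p
    using demazure_mult by (simp add: y_def z_def t_def)
  have nz: "x - y \<noteq> 0" "y - z \<noteq> 0" "x - z \<noteq> 0"
    by (simp_all add: x_def y_def z_def var_neq)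
  have left: "V * demazure i (demazure (Suc i) (demazure i f)) = R"
  proof -
    define g where "g = demazure i f"
    define h where "h = demazure (Suc i) g"
    have g: "(x - y) * g = x * f - y * s f" by (simp add: g_def di)
    \<comment> \<open>\<open>t\<close> exchanges \<open>y\<close> and \<open>z\<close>, so the
      denominator \<open>x - y\<close> of \<open>g\<close> becomes \<open>x - z\<close>, the third
      factor of \<open>V\<close>.\<close>
    have tg: "(x - z) * t g = x * t f - z * t (s f)"
      using arg_cong[OF g, of t] by (simp add: hom sv)
    have h: "(y - z) * h = y * g - z * t g" by (simp add: h_def dj)
    have Vh: "V * h = y * (x - z) * (x * f - y * s f) - z * (x - y) * (x * t f - z * t (s f))"
      unfolding g[symmetric] tg[symmetric] using h unfolding V_def by algebra
    \<comment> \<open>The sign comes from the antisymmetry of \<open>V\<close>: \<open>s\<close>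
      sends it to \<open>- V\<close>.\<close>
    have Vsh: "- (V * s h) = x * (y - z) * (y * s f - x * f)
        - z * (y - x) * (y * s (t f) - z * t (s (t f)))"
      using arg_cong[OF Vh, of s] unfolding V_def hom sv by algebra
    have d: "(x - y) * demazure i h = x * h - y * s h" by (rule di)
    have "(x - y) * (V * demazure i h) = x * (V * h) + y * (- (V * s h))"
      using d by algebra
    also have "\<dots> = (x - y) * R"
      unfolding Vh Vsh R_def by algebra
    finally show ?thesis using nz by (simp add: h_def g_def)
  qed
  have right: "V * demazure (Suc i) (demazure i (demazure (Suc i) f)) = R"
  proof -
    define g where "g = demazure (Suc i) f"
    define h where "h = demazure i g"
    have g: "(y - z) * g = y * f - z * t f" by (simp add: g_def dj)
    have sg: "(x - z) * s g = x * s f - z * s (t f)"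
      using arg_cong[OF g, of s] by (simp add: hom sv)
    have h: "(x - y) * h = x * g - y * s g" by (simp add: h_def di)
    have Vh: "V * h = x * (x - z) * (y * f - z * t f) - y * (y - z) * (x * s f - z * s (t f))"
      unfolding g[symmetric] sg[symmetric] using h unfolding V_def by algebra
    have Vth: "- (V * t h) = x * (x - y) * (z * t f - y * f)
        - z * (z - y) * (x * t (s f) - y * t (s (t f)))"
      using arg_cong[OF Vh, of t] unfolding V_def hom sv by algebra
    have d: "(y - z) * demazure (Suc i) h = y * h - z * t h" by (rule dj)
    have "(y - z) * (V * demazure (Suc i) h) = y * (V * h) + z * (- (V * t h))"
      using d by algebra
    also have "\<dots> = (y - z) * R"
      unfolding Vh Vth R_def by algebra
    finally show ?thesis using nz by (simp add: h_def g_def)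
  qed
  have "V \<noteq> 0" using nz by (simp add: V_def)
  with left right show ?thesis by (metis mult_left_cancel)
qed

section \<open>Independence of the choice of ascents\<close>

lemma entry_adj:
  "entry (adj i \<gamma>) k = (if k = i then entry \<gamma> (Suc i) else if k = Suc i then entry \<gamma> i else entry \<gamma> k)"
  by (simp add: lookup_interchange Transposition.transpose_def)

lemma adj_commute: "Suc i < j \<or> Suc j < i \<Longrightarrow> adj i (adj j \<gamma>) = adj j (adj i \<gamma>)"
  by (rule poly_mapping_eqI) (auto simp: entry_adj)

lemma adj_braid: "adj i (adj (Suc i) (adj i \<gamma>)) = adj (Suc i) (adj i (adj (Suc i) \<gamma>))"
  by (rule poly_mapping_eqI) (auto simp: entry_adj)

lemma is_ascent_iff: "is_ascent n \<alpha> i \<longleftrightarrow> 1 \<le> i \<and> i < n \<and> entry \<alpha> i < entry \<alpha> (Suc i)"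
  by (auto simp: is_ascent_def)

lemma ascent_induct [case_names less]:
  assumes "\<And>\<alpha>. (\<And>\<beta>. (\<Sum>k=1..n. k * entry \<beta> k) < (\<Sum>k=1..n. k * entry \<alpha> k) \<Longrightarrow> P \<beta>) \<Longrightarrow> P \<alpha>"
  shows "P \<alpha>"
  by (rule measure_induct_rule[where f = "\<lambda>\<alpha>. \<Sum>k=1..n. k * entry \<alpha> k"]) (rule assms)

text \<open>A diamond argument by induction on the weight used for termination: two different
  ascents lead, after further ascents, to a common composition, and the two words in the operators
  agree by commutation or by the braid relation.\<close>

lemma key_poly_ascent:
  assumes "is_ascent n \<alpha> i"
  shows "key_poly n \<alpha> = demazure i (key_poly n (adj i \<alpha>))"
  using assms
proof (induction \<alpha> arbitrary: i rule: ascent_induct[where n = n])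
  case (less \<alpha>)
  let ?wt = "\<lambda>\<beta>. \<Sum>k=1..n. k * entry \<beta> k"
  have wt: "?wt (adj k \<beta>) < ?wt \<beta>" if "is_ascent n \<beta> k" for \<beta> k
    using interchange_weight_less[OF that] by simp
  have IH: "key_poly n \<beta> = demazure k (key_poly n (adj k \<beta>))"
    if "?wt \<beta> < ?wt \<alpha>" "is_ascent n \<beta> k" for \<beta> k
    using less.IH that by blast
  have main: "demazure i (key_poly n (adj i \<alpha>)) = demazure j (key_poly n (adj j \<alpha>))"
    if i: "is_ascent n \<alpha> i" and j: "is_ascent n \<alpha> j" and ij: "i < j" for i j
  proof (cases "j = Suc i")
    case True
    \<comment> \<open>The entries at \<open>i\<close>, \<open>i + 1\<close>, \<open>i + 2\<close>
      increase strictly, so both reduced words for their reversal use only ascents.\<close>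
    have a: "is_ascent n (adj i \<alpha>) j" "is_ascent n (adj j (adj i \<alpha>)) i"
      "is_ascent n (adj j \<alpha>) i" "is_ascent n (adj i (adj j \<alpha>)) j"
      using i j by (auto simp: is_ascent_iff entry_adj True)
    have "key_poly n (adj i \<alpha>)
        = demazure j (demazure i (key_poly n (adj i (adj j (adj i \<alpha>)))))"
      using IH[OF wt[OF i] a(1)] IH[OF less_trans[OF wt[OF a(1)] wt[OF i]] a(2)] by (rule trans[OF _ arg_cong])
    moreover have "key_poly n (adj j \<alpha>)
        = demazure i (demazure j (key_poly n (adj j (adj i (adj j \<alpha>)))))"
      using IH[OF wt[OF j] a(3)] IH[OF less_trans[OF wt[OF a(3)] wt[OF j]] a(4)] by (rule trans[OF _ arg_cong])
    ultimately show ?thesis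
      by (simp add: True adj_braid demazure_braid)
  next
    case False
    then have far: "Suc i < j \<or> Suc j < i" using ij by simp
    have a: "is_ascent n (adj i \<alpha>) j" "is_ascent n (adj j \<alpha>) i"
      using i j False ij by (auto simp: is_ascent_iff entry_adj)
    show ?thesis
      unfolding IH[OF wt[OF i] a(1)] IH[OF wt[OF j] a(2)] adj_commute[OF far]
      by (rule demazure_commute[OF far])
  qed
  define j where "j = (SOME i. is_ascent n \<alpha> i)"
  have j: "is_ascent n \<alpha> j"
    unfolding j_def using less.prems by (rule someI)
  have "\<not> weakly_decreasing n \<alpha>"
    using less.prems by (auto simp: weakly_decreasing_def is_ascent_def not_le)
  then have key: "key_poly n \<alpha> = demazure j (key_poly n (adj j \<alpha>))"
    using key_poly.simps[of n \<alpha>] by (simp only: j_def Let_def if_False Suc_eq_plus1)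
  have "demazure i (key_poly n (adj i \<alpha>)) = demazure j (key_poly n (adj j \<alpha>))"
  proof (cases i j rule: linorder_cases)
    case less
    then show ?thesis by (rule main[OF less.prems j])
  next
    case equal
    then show ?thesis by (simp only:)
  next
    case greater
    then show ?thesis by (rule main[OF j less.prems, symmetric])
  qed
  with key show ?case by (simp only:)
qed

lemma key_poly_dominant: "weakly_decreasing n \<alpha> \<Longrightarrow> key_poly n \<alpha> = monomial \<alpha>"
  by (simp add: key_poly.simps)

lemma key_poly_induct [case_names dominant ascent]:
  assumes "\<And>\<alpha>. weakly_decreasing n \<alpha> \<Longrightarrow> P \<alpha>"
    and "\<And>\<alpha> i. is_ascent n \<alpha> i \<Longrightarrow>
      (\<And>\<beta>. (\<Sum>k=1..n. k * entry \<beta> k) < (\<Sum>k=1..n. k * entry \<alpha> k) \<Longrightarrow> P \<beta>) \<Longrightarrow> P (adj i \<alpha>) \<Longrightarrow> P \<alpha>"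
  shows "P \<alpha>"
proof (induction \<alpha> rule: ascent_induct[where n = n])
  case (less \<alpha>)
  show ?case
  proof (cases "weakly_decreasing n \<alpha>")
    case False
    then obtain i where "is_ascent n \<alpha> i" using ex_ascent by blast
    then show ?thesis
      using assms(2) less interchange_weight_less[of n \<alpha> i] by simp
  qed (rule assms(1))
qed

text \<open>Induction along an ascent \<open>j\<close> of \<open>\<alpha>\<close>. If
  \<open>j\<close> is far from \<open>i\<close> the operators commute; if it is adjacent, the braid
  relation trades the claim for the same claim at index \<open>j\<close> for a composition of
  smaller weight.\<close>

lemma demazure_key_poly_equal:
  assumes "1 \<le> i" "i < n" "entry \<alpha> i = entry \<alpha> (Suc i)"
  shows "demazure i (key_poly n \<alpha>) = key_poly n \<alpha>"
  using assms
proof (induction \<alpha> arbitrary: i rule: key_poly_induct[where n = n])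
  case (dominant \<alpha>)
  have "adj i \<alpha> = \<alpha>"
    using dominant.prems by (intro poly_mapping_eqI) (simp add: entry_adj)
  then have "swap_vars i (monomial \<alpha>) = monomial \<alpha>"
    unfolding monomial_def swap_vars_single by simp
  then show ?case
    by (simp add: key_poly_dominant[OF dominant.hyps] demazure_symmetric)
next
  case (ascent \<alpha> j)
  let ?wt = "\<lambda>\<beta>. \<Sum>k=1..n. k * entry \<beta> k"
  note j = ascent.hyps(1)
  have IH: "demazure k (key_poly n \<beta>) = key_poly n \<beta>"
    if "?wt \<beta> < ?wt \<alpha>" "1 \<le> k" "k < n" "entry \<beta> k = entry \<beta> (Suc k)" for \<beta> k
    using ascent.IH(1) that by blast
  have wt: "?wt (adj k \<beta>) < ?wt \<beta>" if "is_ascent n \<beta> k" for \<beta> k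
    using interchange_weight_less[OF that] by simp
  have ij: "i \<noteq> j" using j ascent.prems by (auto simp: is_ascent_iff)
  consider "Suc i < j \<or> Suc j < i" | "j = Suc i" | "i = Suc j" using ij by linarith
  then show ?case
  proof cases
    case 1
    have "demazure i (key_poly n (adj j \<alpha>)) = key_poly n (adj j \<alpha>)"
      using IH[OF wt[OF j]] ascent.prems 1 by (auto simp: entry_adj)
    then show ?thesis
      by (simp add: key_poly_ascent[OF j] demazure_commute[OF 1])
  next
    case 2
    have i: "is_ascent n (adj j \<alpha>) i"
      using j ascent.prems by (auto simp: is_ascent_iff entry_adj 2)
    \<comment> \<open>Entries \<open>(a, a, b)\<close> at \<open>i\<close>, \<open>i + 1\<close>,
      \<open>i + 2\<close> become \<open>(b, a, a)\<close>, so the induction hypothesis applies at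
      index \<open>j\<close>.\<close>
    have "?wt (adj i (adj j \<alpha>)) < ?wt \<alpha>"
      using wt[OF i] wt[OF j] by linarith
    then have *: "demazure j (key_poly n (adj i (adj j \<alpha>))) = key_poly n (adj i (adj j \<alpha>))"
      using j ascent.prems by (intro IH) (auto simp: is_ascent_iff entry_adj 2)
    show ?thesis
      unfolding key_poly_ascent[OF j] key_poly_ascent[OF i]
      using demazure_braid[of i "key_poly n (adj i (adj j \<alpha>))"] * by (simp add: 2)
  next
    case 3
    have i: "is_ascent n (adj j \<alpha>) i"
      using j ascent.prems by (auto simp: is_ascent_iff entry_adj 3)
    have "?wt (adj i (adj j \<alpha>)) < ?wt \<alpha>"
      using wt[OF i] wt[OF j] by linarith
    then have *: "demazure j (key_poly n (adj i (adj j \<alpha>))) = key_poly n (adj i (adj j \<alpha>))"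
      using j ascent.prems by (intro IH) (auto simp: is_ascent_iff entry_adj 3)
    show ?thesis
      unfolding key_poly_ascent[OF j] key_poly_ascent[OF i]
      using demazure_braid[of j "key_poly n (adj i (adj j \<alpha>))"] * by (simp add: 3)
  qed
qed

text \<open>The action of the 0-Hecke monoid on indices that matches the action of the Demazure
  operators on key polynomials.\<close>

definition raise :: "nat \<Rightarrow> expvec \<Rightarrow> expvec" where
  "raise i \<alpha> = (if entry \<alpha> i > entry \<alpha> (Suc i) then adj i \<alpha> else \<alpha>)"

lemma demazure_key_poly:
  assumes "1 \<le> i" "i < n"
  shows "demazure i (key_poly n \<alpha>) = key_poly n (raise i \<alpha>)"
proof -
  consider "entry \<alpha> i > entry \<alpha> (Suc i)" | "entry \<alpha> i = entry \<alpha> (Suc i)" | "is_ascent n \<alpha> i"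
    using assms by (force simp: is_ascent_iff)
  then show ?thesis
  proof cases
    case 1
    then have "is_ascent n (adj i \<alpha>) i"
      using assms by (simp add: is_ascent_iff entry_adj)
    from key_poly_ascent[OF this] show ?thesis using 1 by (simp add: raise_def)
  next
    case 2
    then show ?thesis using assms by (simp add: demazure_key_poly_equal raise_def)
  next
    case 3
    then show ?thesis by (simp add: key_poly_ascent[OF 3] raise_def is_ascent_iff)
  qed
qed

text \<open>As the last entry is a minimum, sorting the first \<open>n\<close> entries by ascents
  \<open>i < n\<close> already sorts all \<open>n + 1\<close> entries. Both recursions can therefore
  follow the same ascents.\<close>

lemma key_poly_Suc:
  assumes "\<And>j. 1 \<le> j \<Longrightarrow> j \<le> n \<Longrightarrow> entry \<alpha> (Suc n) \<le> entry \<alpha> j"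
  shows "key_poly (Suc n) \<alpha> = key_poly n \<alpha>"
  using assms
proof (induction \<alpha> rule: key_poly_induct[where n = n])
  case (dominant \<alpha>)
  then have "weakly_decreasing (Suc n) \<alpha>"
    by (auto simp: weakly_decreasing_def less_Suc_eq)
  with dominant show ?case by (simp add: key_poly_dominant)
next
  case (ascent \<alpha> i)
  have i: "is_ascent (Suc n) \<alpha> i" using ascent.hyps by (simp add: is_ascent_iff)
  have "key_poly (Suc n) (adj i \<alpha>) = key_poly n (adj i \<alpha>)"
    using ascent.prems ascent.hyps(1) by (intro ascent.IH(2)) (auto simp: entry_adj is_ascent_iff)
  then show ?case
    by (simp add: key_poly_ascent[OF i] key_poly_ascent[OF ascent.hyps(1)])
qed

section \<open>Branching from \<open>n + 1\<close> to \<open>n\<close> variables\<close>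

abbreviation put :: "nat \<Rightarrow> nat \<Rightarrow> expvec \<Rightarrow> expvec" where
  "put \<equiv> Poly_Mapping.update"

lemma entry_put: "entry (put k v \<gamma>) j = (if j = k then v else entry \<gamma> j)"
  by (simp add: lookup_update)

lemma expvec_eq_iff: "(\<gamma> :: expvec) = \<delta> \<longleftrightarrow> (\<forall>j. entry \<gamma> j = entry \<delta> j)"
  by (auto intro: poly_mapping_eqI)

definition polyset :: "expvec set \<Rightarrow> expvec \<Rightarrow>\<^sub>0 int" where
  "polyset X = (\<Sum>\<gamma>\<in>X. monomial \<gamma>)"

lemma coef_sum: "coef (\<Sum>x\<in>X. f x) \<gamma> = (\<Sum>x\<in>X. coef (f x) \<gamma>)"
  by (induction X rule: infinite_finite_induct) (simp_all add: lookup_add)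

lemma coef_polyset: "finite X \<Longrightarrow> coef (polyset X) \<gamma> = (if \<gamma> \<in> X then 1 else 0)"
  by (simp add: polyset_def coef_sum monomial_def lookup_single when_def)

lemma keys_polyset: "finite X \<Longrightarrow> Poly_Mapping.keys (polyset X) = X"
  by (auto simp: in_keys_iff coef_polyset split: if_splits)

lemma var_mult_monomial: "var i * monomial \<gamma> = monomial (put i (Suc (entry \<gamma> i)) \<gamma>)"
proof -
  have "Poly_Mapping.single i 1 + \<gamma> = put i (Suc (entry \<gamma> i)) \<gamma>"
    by (auto simp: expvec_eq_iff entry_put lookup_add lookup_single when_def)
  then show ?thesis by (simp add: var_def monomial_def mult_single)
qed

definition slide :: "nat \<Rightarrow> nat \<Rightarrow> expvec \<Rightarrow> expvec" where
  "slide i k \<gamma> = put (Suc i) (entry \<gamma> (Suc i) + k) (put i (entry \<gamma> i - k) \<gamma>)"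

lemma entry_slide:
  "entry (slide i k \<gamma>) j = (if j = Suc i then entry \<gamma> (Suc i) + k
    else if j = i then entry \<gamma> i - k else entry \<gamma> j)"
  by (simp add: slide_def entry_put)

lemma demazure_monomial:
  assumes "entry \<gamma> (Suc i) \<le> entry \<gamma> i"
  shows "demazure i (monomial \<gamma>) = (\<Sum>k\<le>entry \<gamma> i - entry \<gamma> (Suc i). monomial (slide i k \<gamma>))"
proof (rule demazure_unique)
  define d where "d = entry \<gamma> i - entry \<gamma> (Suc i)"
  \<comment> \<open>\<open>h k\<close> is \<open>var i\<close> times the \<open>k\<close>-th
    monomial of the sum and also \<open>var (Suc i)\<close> times the preceding one, so the sum
    telescopes.\<close>
  define h where "h k = monomial (put (Suc i) (entry \<gamma> (Suc i) + k)
    (put i (Suc (entry \<gamma> i) - k) \<gamma>))" for k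
  have h1: "var i * monomial (slide i k \<gamma>) = h k" if "k \<le> d" for k
    using that assms unfolding var_mult_monomial h_def
    by (intro arg_cong[where f = monomial])
      (auto simp: expvec_eq_iff entry_put entry_slide d_def)
  have h2: "var (Suc i) * monomial (slide i k \<gamma>) = h (Suc k)" for k
    unfolding var_mult_monomial h_def
    by (intro arg_cong[where f = monomial])
      (auto simp: expvec_eq_iff entry_put entry_slide)
  have "(var i - var (Suc i)) * (\<Sum>k\<le>d. monomial (slide i k \<gamma>))
      = (\<Sum>k\<le>d. var i * monomial (slide i k \<gamma>) - var (Suc i) * monomial (slide i k \<gamma>))"
    by (simp add: sum_distrib_left left_diff_distrib)
  also have "\<dots> = (\<Sum>k\<le>d. h k - h (Suc k))"
    by (intro sum.cong) (simp_all add: h1 h2)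
  also have "\<dots> = h 0 - h (Suc d)"
    by (rule sum_telescope)
  also have "h 0 = var i * monomial \<gamma>"
    unfolding var_mult_monomial h_def
    by (intro arg_cong[where f = monomial])
      (auto simp: expvec_eq_iff entry_put)
  also have "h (Suc d) = var (Suc i) * swap_vars i (monomial \<gamma>)"
  proof -
    have "swap_vars i (monomial \<gamma>) = monomial (adj i \<gamma>)"
      by (simp add: monomial_def swap_vars_single)
    moreover have "put (Suc i) (entry \<gamma> (Suc i) + Suc d) (put i (Suc (entry \<gamma> i) - Suc d) \<gamma>)
        = put (Suc i) (Suc (entry (adj i \<gamma>) (Suc i))) (adj i \<gamma>)"
      using assms by (auto simp: expvec_eq_iff entry_put entry_adj d_def)
    ultimately show ?thesis by (simp only: h_def var_mult_monomial)
  qed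
  finally show "(var i - var (Suc i)) * (\<Sum>k\<le>entry \<gamma> i - entry \<gamma> (Suc i). monomial (slide i k \<gamma>))
      = var i * monomial \<gamma> - var (Suc i) * swap_vars i (monomial \<gamma>)"
    by (simp add: d_def)
qed

text \<open>The vector with entry \<open>c\<close> at \<open>i + 1\<close> in which two neighbouring
  entries keep their sum. It recovers the start of a string from any of its members.\<close>

definition head :: "nat \<Rightarrow> nat \<Rightarrow> expvec \<Rightarrow> expvec" where
  "head i c \<beta> = put (Suc i) c (put i (entry \<beta> i + entry \<beta> (Suc i) - c) \<beta>)"

lemma entry_head:
  "entry (head i c \<beta>) j = (if j = Suc i then c
    else if j = i then entry \<beta> i + entry \<beta> (Suc i) - c else entry \<beta> j)"
  by (simp add: head_def entry_put)

text \<open>All vectors in \<open>X\<close> share the entry \<open>c\<close> at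
  \<open>i + 1\<close>, so their strings are disjoint: each member determines its start through
  \<open>head i c\<close>. Hence no monomial is produced twice.\<close>

lemma demazure_polyset:
  assumes "finite X" and X: "\<And>\<gamma>. \<gamma> \<in> X \<Longrightarrow> entry \<gamma> (Suc i) = c \<and> c \<le> entry \<gamma> i"
  shows "demazure i (polyset X)
    = polyset {\<beta>. c \<le> entry \<beta> i \<and> c \<le> entry \<beta> (Suc i) \<and> head i c \<beta> \<in> X}"
proof -
  let ?S = "SIGMA \<gamma>:X. {..entry \<gamma> i - c}"
  have "demazure i (polyset X) = (\<Sum>\<gamma>\<in>X. \<Sum>k\<le>entry \<gamma> i - c. monomial (slide i k \<gamma>))"
    unfolding polyset_def demazure_sum using X by (intro sum.cong) (auto simp: demazure_monomial)
  also have "\<dots> = (\<Sum>(\<gamma>, k)\<in>?S. monomial (slide i k \<gamma>))"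
    using assms(1) by (subst sum.Sigma) auto
  also have "\<dots> = polyset {\<beta>. c \<le> entry \<beta> i \<and> c \<le> entry \<beta> (Suc i) \<and> head i c \<beta> \<in> X}"
    unfolding polyset_def
  proof (rule sum.reindex_bij_witness[where i = "\<lambda>\<beta>. (head i c \<beta>, entry \<beta> (Suc i) - c)"
        and j = "\<lambda>(\<gamma>, k). slide i k \<gamma>"])
    fix p assume p: "p \<in> ?S"
    then obtain \<gamma> k where pk: "p = (\<gamma>, k)" "\<gamma> \<in> X" "k \<le> entry \<gamma> i - c" by auto
    have "head i c (slide i k \<gamma>) = \<gamma>"
      using X[OF pk(2)] pk(3) by (auto simp: expvec_eq_iff entry_head entry_slide)
    then show "(head i c (case p of (\<gamma>, k) \<Rightarrow> slide i k \<gamma>),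
        entry (case p of (\<gamma>, k) \<Rightarrow> slide i k \<gamma>) (Suc i) - c) = p"
      "(case p of (\<gamma>, k) \<Rightarrow> slide i k \<gamma>)
        \<in> {\<beta>. c \<le> entry \<beta> i \<and> c \<le> entry \<beta> (Suc i) \<and> head i c \<beta> \<in> X}"
      using X[OF pk(2)] pk by (auto simp: entry_slide)
  next
    fix \<beta> assume "\<beta> \<in> {\<beta>. c \<le> entry \<beta> i \<and> c \<le> entry \<beta> (Suc i) \<and> head i c \<beta> \<in> X}"
    then show "(case (head i c \<beta>, entry \<beta> (Suc i) - c) of (\<gamma>, k) \<Rightarrow> slide i k \<gamma>) = \<beta>"
      "(head i c \<beta>, entry \<beta> (Suc i) - c) \<in> ?S"
      by (auto simp: expvec_eq_iff entry_head entry_slide)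
  qed auto
  finally show ?thesis .
qed

section \<open>Nonnegative combinations of key polynomials\<close>

inductive keysum :: "nat \<Rightarrow> (expvec \<Rightarrow> bool) \<Rightarrow> (expvec \<Rightarrow>\<^sub>0 int) \<Rightarrow> bool" for n Q where
  zero: "keysum n Q 0"
| add: "Q \<nu> \<Longrightarrow> keysum n Q f \<Longrightarrow> keysum n Q (key_poly n \<nu> + f)"

lemma keysum_add: "keysum n Q f \<Longrightarrow> keysum n Q g \<Longrightarrow> keysum n Q (f + g)"
  by (induction rule: keysum.induct) (auto simp: add.assoc intro: keysum.add)

lemma keysum_sum: "(\<And>x. x \<in> X \<Longrightarrow> keysum n Q (f x)) \<Longrightarrow> keysum n Q (\<Sum>x\<in>X. f x)"
  by (induction X rule: infinite_finite_induct) (auto intro: keysum_add keysum.zero)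

lemma keysum_single: "Q \<nu> \<Longrightarrow> keysum n Q (key_poly n \<nu>)"
  using keysum.add[OF _ keysum.zero] by fastforce

text \<open>\<open>Q\<close> records bounds on the indices, such as those that let
  \<open>key_poly_Suc\<close> identify key polynomials in different numbers of variables.\<close>

lemma keysum_change:
  assumes "keysum n Q f" "\<And>\<nu>. Q \<nu> \<Longrightarrow> Q' \<nu> \<and> key_poly n \<nu> = key_poly n' \<nu>"
  shows "keysum n' Q' f"
  using assms(1)
proof (induction rule: keysum.induct)
  case zero
  show ?case by (rule keysum.zero)
next
  case (add \<nu> f)
  from assms(2)[OF add(1)] add(3) show ?case by (auto intro: keysum.add)
qed

lemma keysum_demazure:
  assumes "keysum n Q f" "1 \<le> i" "i < n" "\<And>\<nu>. Q \<nu> \<Longrightarrow> Q' (raise i \<nu>)"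
  shows "keysum n Q' (demazure i f)"
  using assms(1)
proof (induction rule: keysum.induct)
  case zero
  show ?case by (simp add: keysum.zero)
next
  case (add \<nu> f)
  then show ?case
    using assms by (simp add: demazure_add demazure_key_poly keysum.add)
qed

section \<open>Explicit monomials for indices that decrease up to their last entry\<close>

abbreviation psum :: "expvec \<Rightarrow> nat \<Rightarrow> nat" where
  "psum \<gamma> j \<equiv> (\<Sum>k=Suc 0..j. entry \<gamma> k)"

lemma psum_put [simp]: "j < k \<Longrightarrow> psum (put k v \<gamma>) j = psum \<gamma> j"
  by (intro sum.cong) (auto simp: entry_put)

lemma finite_bounded_expvecs:
  "finite {\<gamma> :: expvec. (\<forall>j>b. entry \<gamma> j = entry \<alpha> j) \<and> (\<forall>j\<le>b. entry \<gamma> j \<le> N)}" (is "finite ?X")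
proof (rule finite_imageD)
  let ?f = "\<lambda>\<gamma>. map (entry \<gamma>) [0..<Suc b]"
  have "?f ` ?X \<subseteq> {xs. set xs \<subseteq> {..N} \<and> length xs = Suc b}" by auto
  then show "finite (?f ` ?X)"
    by (rule finite_subset) (simp add: finite_lists_length_eq)
  show "inj_on ?f ?X"
  proof (rule inj_onI)
    fix \<gamma> \<delta> assume *: "\<gamma> \<in> ?X" "\<delta> \<in> ?X" "?f \<gamma> = ?f \<delta>"
    have "entry \<gamma> j = entry \<delta> j" for j
      using * by (cases "j \<le> b") (auto simp: map_eq_conv simp del: upt_Suc)
    then show "\<gamma> = \<delta>" by (rule poly_mapping_eqI)
  qed
qed

text \<open>These inequalities describe the monomials that arise when the entry \<open>M\<close> at the end of
  \<open>\<alpha>\<close> is carried through the positions \<open>1, \<dots>, b\<close> by \<open>\<pi>\<^sub>1, \<dots>, \<pi>\<^sub>b\<close>, starting from the decreasing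
  rearrangement. The truncated subtraction is intended: positions with \<open>\<alpha>\<^sub>j \<ge> M\<close> stay fixed.\<close>

definition strip :: "nat \<Rightarrow> nat \<Rightarrow> expvec \<Rightarrow> expvec set" where
  "strip M b \<alpha> = {\<gamma>. \<forall>j. 1 \<le> j \<and> j \<le> b \<longrightarrow>
    entry \<alpha> j \<le> entry \<gamma> j \<and> psum \<gamma> j \<le> psum \<alpha> j + (M - entry \<alpha> j)}"

text \<open>The index \<open>0\<close> counts as outside: variables are numbered from
  \<open>1\<close>, while vectors are functions on all of \<open>nat\<close>.\<close>

definition agree :: "nat \<Rightarrow> expvec \<Rightarrow> expvec set" where
  "agree b \<alpha> = {\<gamma>. \<forall>j. j = 0 \<or> b < j \<longrightarrow> entry \<gamma> j = entry \<alpha> j}"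

lemma psum_ge_entry: "1 \<le> j \<Longrightarrow> j \<le> b \<Longrightarrow> entry \<gamma> j \<le> psum \<gamma> b"
  by (rule member_le_sum) auto

lemma finite_agree: "finite {\<gamma> \<in> agree b \<alpha>. psum \<gamma> b \<le> N}"
proof (rule finite_subset[OF _ finite_bounded_expvecs[of b \<alpha> "N + entry \<alpha> 0"]])
  have "entry \<gamma> j \<le> N + entry \<alpha> 0" if "\<gamma> \<in> agree b \<alpha>" "psum \<gamma> b \<le> N" "j \<le> b" for \<gamma> j
  proof (cases j)
    case 0
    then show ?thesis using that by (simp add: agree_def)
  next
    case (Suc k)
    then show ?thesis using that psum_ge_entry[of j b \<gamma>] by simp
  qed
  then show "{\<gamma> \<in> agree b \<alpha>. psum \<gamma> b \<le> N}
      \<subseteq> {\<gamma>. (\<forall>j>b. entry \<gamma> j = entry \<alpha> j) \<and> (\<forall>j\<le>b. entry \<gamma> j \<le> N + entry \<alpha> 0)}"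
    by (auto simp: agree_def)
qed

text \<open>Here \<open>m\<close> is the total surplus over \<open>\<alpha>\<close> in positions
  \<open>1\<close> to \<open>b\<close>. Fixing the exponent of the next variable in
  \<open>expansion\<close> leaves such a layer, which makes layers the right objects for an
  induction on \<open>b\<close>.\<close>

definition strip_layer :: "nat \<Rightarrow> nat \<Rightarrow> expvec \<Rightarrow> nat \<Rightarrow> expvec set" where
  "strip_layer M b \<alpha> m = strip M b \<alpha> \<inter> {\<gamma> \<in> agree b \<alpha>. psum \<gamma> b = psum \<alpha> b + m}"

lemma finite_strip_layer: "finite (strip_layer M b \<alpha> m)"
  by (rule finite_subset[OF _ finite_agree[of b \<alpha> "psum \<alpha> b + m"]]) (auto simp: strip_layer_def)

lemma weakly_decreasing_Suc:
  "weakly_decreasing (Suc b) \<alpha> \<longleftrightarrow>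
    weakly_decreasing b \<alpha> \<and> (1 \<le> b \<longrightarrow> entry \<alpha> (Suc b) \<le> entry \<alpha> b)"
  by (auto simp: weakly_decreasing_def less_Suc_eq)

lemma weakly_decreasing_cong:
  assumes "\<And>j. 1 \<le> j \<Longrightarrow> j \<le> b \<Longrightarrow> entry \<alpha> j = entry \<beta> j"
  shows "weakly_decreasing b \<alpha> \<longleftrightarrow> weakly_decreasing b \<beta>"
  using assms by (auto simp: weakly_decreasing_def)

lemma weakly_decreasingD:
  assumes "weakly_decreasing b \<alpha>" "1 \<le> i" "i \<le> j" "j \<le> b"
  shows "entry \<alpha> j \<le> entry \<alpha> i"
  using assms(3,4)
proof (induction j rule: dec_induct)
  case (step j)
  then have "entry \<alpha> (Suc j) \<le> entry \<alpha> j"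
    using assms by (auto simp: weakly_decreasing_def)
  with step show ?case by simp
qed simp

lemma psum_head [simp]: "j < i \<Longrightarrow> psum (head i c \<gamma>) j = psum \<gamma> j"
  by (intro sum.cong) (auto simp: entry_head)

lemma psum_mono_strip:
  assumes "\<And>j. 1 \<le> j \<Longrightarrow> j \<le> b \<Longrightarrow> entry \<alpha> j \<le> entry \<gamma> j"
  shows "psum \<alpha> b \<le> psum \<gamma> b"
  using assms by (intro sum_mono) auto

lemma strip_Suc:
  "\<gamma> \<in> strip M (Suc b) \<alpha> \<longleftrightarrow> \<gamma> \<in> strip M b \<alpha> \<and> entry \<alpha> (Suc b) \<le> entry \<gamma> (Suc b)
    \<and> psum \<gamma> (Suc b) \<le> psum \<alpha> (Suc b) + (M - entry \<alpha> (Suc b))"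
  unfolding strip_def by (auto simp: le_Suc_eq)

lemma strip_put [simp]: "strip M b (put (Suc b) v \<alpha>) = strip M b \<alpha>"
  by (simp add: strip_def entry_put)

lemma agree_put:
  "\<gamma> \<in> agree b (put (Suc b) v \<alpha>) \<longleftrightarrow> \<gamma> \<in> agree (Suc b) \<alpha> \<and> entry \<gamma> (Suc b) = v"
  by (auto simp: agree_def entry_put)

lemma agree_0: "agree 0 \<alpha> = {\<alpha>}"
  by (auto simp: agree_def expvec_eq_iff)

lemma agree_1: "\<gamma> \<in> agree (Suc 0) \<alpha> \<longleftrightarrow> \<gamma> = put (Suc 0) (entry \<gamma> (Suc 0)) \<alpha>"
  unfolding agree_def expvec_eq_iff entry_put mem_Collect_eq
  by (metis Suc_lessI neq0_conv less_irrefl_nat zero_neq_one One_nat_def)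

lemma strip_head:
  assumes "j < i"
  shows "head i c \<gamma> \<in> strip M j \<alpha> \<longleftrightarrow> \<gamma> \<in> strip M j \<alpha>"
proof -
  have "psum (head i c \<gamma>) k = psum \<gamma> k" "entry (head i c \<gamma>) k = entry \<gamma> k" if "k \<le> j" for k
    using that assms by (simp_all add: entry_head)
  then show ?thesis by (simp add: strip_def)
qed

lemma agree_head:
  "head (Suc i) c \<gamma> \<in> agree (Suc (Suc i)) \<alpha> \<longleftrightarrow> \<gamma> \<in> agree (Suc (Suc i)) \<alpha>"
  by (simp add: agree_def entry_head)

lemma strip_layer_slice:
  assumes "entry \<alpha> (Suc b) \<le> v" "v \<le> entry \<alpha> (Suc b) + m" "m \<le> M - entry \<alpha> (Suc b)"
  shows "{\<gamma> \<in> strip_layer M (Suc b) \<alpha> m. entry \<gamma> (Suc b) = v}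
    = strip_layer M b (put (Suc b) v \<alpha>) (m + entry \<alpha> (Suc b) - v)"
  using assms by (auto simp: strip_layer_def strip_Suc agree_put)

text \<open>When the entry at \<open>b + 1\<close> is at least \<open>c\<close>, the bound on the
  partial sum at \<open>b\<close> follows from the total. The vectors in question therefore form
  whole strings, in the shape required by \<open>demazure_polyset\<close>.\<close>

lemma strip_layer_top:
  assumes "entry \<alpha> (Suc b) \<le> c" "c \<le> entry \<alpha> (Suc b) + m" "m \<le> M - entry \<alpha> (Suc b)"
    and "1 \<le> b" "c = entry \<alpha> b"
  shows "{\<gamma> \<in> strip_layer M (Suc b) \<alpha> m. c \<le> entry \<gamma> (Suc b)}
    = {\<beta>. c \<le> entry \<beta> b \<and> c \<le> entry \<beta> (Suc b)
        \<and> head b c \<beta> \<in> strip_layer M b (put (Suc b) c \<alpha>) (m + entry \<alpha> (Suc b) - c)}"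
proof -
  obtain b' where b: "b = Suc b'" using assms(4) by (cases b) auto
  show ?thesis
    unfolding b strip_layer_def using assms(1-3)[unfolded b] assms(5)[unfolded b]
    by (auto simp: strip_Suc agree_put entry_put entry_head strip_head agree_head)
qed

lemma raise_bound:
  assumes "1 \<le> i" "i < n" "\<And>j. 1 \<le> j \<Longrightarrow> j \<le> n \<Longrightarrow> c \<le> entry \<nu> j" "1 \<le> j" "j \<le> n"
  shows "c \<le> entry (raise i \<nu>) j"
  using assms by (simp add: raise_def entry_adj)

lemma polyset_split:
  assumes "finite A"
  shows "polyset A = (\<Sum>v\<in>g ` A. polyset {\<gamma> \<in> A. g \<gamma> = v})"
  unfolding polyset_def using assms by (simp add: sum.image_gen)

text \<open>A layer in \<open>b + 1\<close> variables is cut by the exponent of the last one at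
  \<open>c\<close>, the entry of \<open>\<alpha>\<close> at \<open>b\<close>. Below \<open>c\<close>
  every slice is a layer in \<open>b\<close> variables; the rest is \<open>demazure b\<close> of the
  slice at \<open>c\<close>. The lower bound on the indices is what allows the passage from
  \<open>b\<close> to \<open>b + 1\<close> variables.\<close>

lemma keysum_strip_layer:
  assumes "1 \<le> b" "weakly_decreasing b \<alpha>"
  shows "keysum b (\<lambda>\<nu>. (\<forall>j. 1 \<le> j \<and> j \<le> b \<longrightarrow> entry \<alpha> b \<le> entry \<nu> j) \<and>
    (\<forall>j>b. entry \<nu> j = entry \<alpha> j)) (polyset (strip_layer M b \<alpha> m))"
  using assms
proof (induction b arbitrary: \<alpha> m rule: dec_induct)
  case base
  let ?\<nu> = "put 1 (entry \<alpha> 1 + m) \<alpha>"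
  have "strip_layer M 1 \<alpha> m = (if m \<le> M - entry \<alpha> 1 then {?\<nu>} else {})"
  proof (intro set_eqI iffI)
    fix \<gamma> assume \<gamma>: "\<gamma> \<in> strip_layer M 1 \<alpha> m"
    then have "entry \<gamma> 1 = entry \<alpha> 1 + m" "m \<le> M - entry \<alpha> 1"
      by (auto simp: strip_layer_def strip_Suc)
    moreover have "\<gamma> \<in> agree (Suc 0) \<alpha>"
      using \<gamma> by (simp add: strip_layer_def)
    ultimately show "\<gamma> \<in> (if m \<le> M - entry \<alpha> 1 then {?\<nu>} else {})"
      using agree_1[of \<gamma> \<alpha>] by simp
  next
    fix \<gamma> assume "\<gamma> \<in> (if m \<le> M - entry \<alpha> 1 then {?\<nu>} else {})"
    then show "\<gamma> \<in> strip_layer M 1 \<alpha> m"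
      by (auto simp: strip_layer_def strip_Suc agree_def entry_put strip_def[of _ 0] split: if_splits)
  qed
  moreover have "monomial ?\<nu> = key_poly 1 ?\<nu>"
    by (simp add: key_poly_dominant weakly_decreasing_def)
  ultimately show ?case
    by (auto simp: polyset_def entry_put intro!: keysum.zero keysum_single)
next
  case (step b)
  let ?A = "strip_layer M (Suc b) \<alpha> m"
  define a c where "a = entry \<alpha> (Suc b)" and "c = entry \<alpha> b"
  define Q where "Q \<nu> \<longleftrightarrow> (\<forall>j. 1 \<le> j \<and> j \<le> Suc b \<longrightarrow> a \<le> entry \<nu> j) \<and>
    (\<forall>j>Suc b. entry \<nu> j = entry \<alpha> j)" for \<nu>
  have wd: "weakly_decreasing b \<alpha>" and ac: "a \<le> c"
    using step by (auto simp: weakly_decreasing_Suc a_def c_def)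
  have ge: "a \<le> x" if "c \<le> x" for x
    using that ac by simp
  have slice: "keysum b (\<lambda>\<nu>. (\<forall>j. 1 \<le> j \<and> j \<le> b \<longrightarrow> c \<le> entry \<nu> j) \<and> entry \<nu> (Suc b) = v \<and>
      (\<forall>j>Suc b. entry \<nu> j = entry \<alpha> j)) (polyset (strip_layer M b (put (Suc b) v \<alpha>) k))"
    for v k
  proof -
    have "weakly_decreasing b (put (Suc b) v \<alpha>)"
      using wd by (rule weakly_decreasing_cong[THEN iffD1, rotated]) (simp add: entry_put)
    then have "keysum b (\<lambda>\<nu>. (\<forall>j. 1 \<le> j \<and> j \<le> b \<longrightarrow> entry (put (Suc b) v \<alpha>) b \<le> entry \<nu> j) \<and>
        (\<forall>j>b. entry \<nu> j = entry (put (Suc b) v \<alpha>) j))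
        (polyset (strip_layer M b (put (Suc b) v \<alpha>) k))"
      using step by blast
    then show ?thesis
      by (rule keysum_change) (auto simp: entry_put c_def)
  qed
  \<comment> \<open>Since \<open>v \<le> c\<close>, the entry \<open>v\<close> at
    \<open>b + 1\<close> is a minimum of each index that occurs, so \<open>key_poly_Suc\<close>
    applies.\<close>
  have Suc_slice: "keysum (Suc b) Q' (polyset (strip_layer M b (put (Suc b) v \<alpha>) k))"
    if "v \<le> c" "\<And>\<nu>. \<lbrakk>\<And>j. \<lbrakk>1 \<le> j; j \<le> b\<rbrakk> \<Longrightarrow> c \<le> entry \<nu> j; entry \<nu> (Suc b) = v;
      \<And>j. Suc b < j \<Longrightarrow> entry \<nu> j = entry \<alpha> j\<rbrakk> \<Longrightarrow> Q' \<nu>" for Q' v k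
  proof (rule keysum_change[OF slice])
    fix \<nu> assume *: "(\<forall>j. 1 \<le> j \<and> j \<le> b \<longrightarrow> c \<le> entry \<nu> j) \<and> entry \<nu> (Suc b) = v \<and>
      (\<forall>j>Suc b. entry \<nu> j = entry \<alpha> j)"
    have "key_poly (Suc b) \<nu> = key_poly b \<nu>"
      using * that(1) by (intro key_poly_Suc) (metis le_trans)
    with * that(2) show "Q' \<nu> \<and> key_poly b \<nu> = key_poly (Suc b) \<nu>" by simp
  qed
  show ?case
  proof (cases "m \<le> M - a")
    case False
    then have "?A = {}" by (auto simp: strip_layer_def strip_Suc a_def)
    then show ?thesis by (simp add: polyset_def keysum.zero)
  next
    case True
    have low: "keysum (Suc b) Q (polyset {\<gamma> \<in> ?A. entry \<gamma> (Suc b) < c})"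
    proof -
      let ?L = "{\<gamma> \<in> ?A. entry \<gamma> (Suc b) < c}"
      have "keysum (Suc b) Q (polyset {\<gamma> \<in> ?L. entry \<gamma> (Suc b) = v})"
        if v: "v \<in> (\<lambda>\<gamma>. entry \<gamma> (Suc b)) ` ?L" for v
      proof -
        obtain \<gamma> where \<gamma>: "\<gamma> \<in> ?A" "entry \<gamma> (Suc b) = v" "v < c" using v by auto
        have "psum \<alpha> b \<le> psum \<gamma> b"
          using \<gamma> by (intro psum_mono_strip) (auto simp: strip_layer_def strip_def)
        then have "a \<le> v" "v \<le> a + m"
          using \<gamma> by (auto simp: strip_layer_def strip_Suc a_def)
        then have "{\<gamma> \<in> ?A. entry \<gamma> (Suc b) = v} = strip_layer M b (put (Suc b) v \<alpha>) (m + a - v)"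
          using strip_layer_slice[of \<alpha> b v m M] True by (simp add: a_def)
        moreover have "{\<gamma> \<in> ?L. entry \<gamma> (Suc b) = v} = {\<gamma> \<in> ?A. entry \<gamma> (Suc b) = v}"
          using \<gamma>(3) by auto
        ultimately have "{\<gamma> \<in> ?L. entry \<gamma> (Suc b) = v} = strip_layer M b (put (Suc b) v \<alpha>) (m + a - v)"
          by (simp only:)
        moreover have "keysum (Suc b) Q (polyset (strip_layer M b (put (Suc b) v \<alpha>) (m + a - v)))"
          using \<open>v < c\<close> ac \<open>a \<le> v\<close>
          by (intro Suc_slice) (auto simp: Q_def le_Suc_eq intro: ge)
        ultimately show ?thesis by (simp only:)
      qed
      then show ?thesis
        by (subst polyset_split[where g = "\<lambda>\<gamma>. entry \<gamma> (Suc b)"])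
          (auto simp: finite_strip_layer intro!: keysum_sum)
    qed
    have high: "keysum (Suc b) Q (polyset {\<gamma> \<in> ?A. c \<le> entry \<gamma> (Suc b)})"
    proof (cases "c \<le> a + m")
      case False
      \<comment> \<open>The first \<open>b\<close> entries of \<open>\<gamma>\<close> dominate those
        of \<open>\<alpha>\<close>, so the surplus \<open>m\<close> can raise the entry at
        \<open>b + 1\<close> to at most \<open>a + m\<close>, which is below
        \<open>c\<close>.\<close>
      have "entry \<gamma> (Suc b) \<le> a + m" if "\<gamma> \<in> ?A" for \<gamma>
      proof -
        have "psum \<alpha> b \<le> psum \<gamma> b"
          using that by (intro psum_mono_strip) (auto simp: strip_layer_def strip_def)
        with that show ?thesis by (auto simp: strip_layer_def a_def)
      qed
      then have "{\<gamma> \<in> ?A. c \<le> entry \<gamma> (Suc b)} = {}" using False by fastforce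
      then show ?thesis by (simp only: polyset_def sum.empty keysum.zero)
    next
      case le: True
      let ?X = "strip_layer M b (put (Suc b) c \<alpha>) (m + a - c)"
      have "polyset {\<gamma> \<in> ?A. c \<le> entry \<gamma> (Suc b)}
          = polyset {\<beta>. c \<le> entry \<beta> b \<and> c \<le> entry \<beta> (Suc b) \<and> head b c \<beta> \<in> ?X}"
        using strip_layer_top[of \<alpha> b c m M] ac le True step.hyps by (simp add: a_def c_def)
      also have "\<dots> = demazure b (polyset ?X)"
      proof (rule demazure_polyset[symmetric])
        show "finite ?X" by (rule finite_strip_layer)
        show "entry \<gamma> (Suc b) = c \<and> c \<le> entry \<gamma> b" if "\<gamma> \<in> ?X" for \<gamma>
          using that step.hyps unfolding strip_layer_def
          by (simp add: agree_put) (simp add: strip_def c_def)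
      qed
      also have "keysum (Suc b) Q \<dots>"
      proof (rule keysum_demazure)
        show "keysum (Suc b) Q (polyset ?X)"
          using ac by (intro Suc_slice) (auto simp: Q_def le_Suc_eq intro: ge)
        show "Q (raise b \<nu>)" if "Q \<nu>" for \<nu>
          using that step.hyps by (simp add: Q_def raise_bound) (simp add: raise_def entry_adj)
      qed (use step.hyps in auto)
      finally show ?thesis .
    qed
    have "polyset ?A = polyset {\<gamma> \<in> ?A. entry \<gamma> (Suc b) < c}
        + polyset {\<gamma> \<in> ?A. c \<le> entry \<gamma> (Suc b)}"
      unfolding polyset_def
      by (subst sum.union_disjoint[symmetric])
        (auto simp: finite_strip_layer intro!: sum.cong)
    then have "keysum (Suc b) Q (polyset ?A)"
      using keysum_add[OF low high] by simp
    then show ?thesis by (rule keysum_change) (simp add: Q_def a_def)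
  qed
qed

text \<open>The support of the key polynomial when only the last entry may be out of order:
  \<open>strip\<close> restricts the first \<open>b\<close> entries and the total degree then fixes
  the last one.\<close>

definition expansion :: "nat \<Rightarrow> expvec \<Rightarrow> expvec set" where
  "expansion b \<alpha> = strip (entry \<alpha> (Suc b)) b \<alpha> \<inter>
    {\<gamma> \<in> agree (Suc b) \<alpha>. psum \<gamma> (Suc b) = psum \<alpha> (Suc b)}"

lemma finite_expansion: "finite (expansion b \<alpha>)"
  by (rule finite_subset[OF _ finite_agree[of "Suc b" \<alpha> "psum \<alpha> (Suc b)"]])
    (auto simp: expansion_def)

text \<open>Induction on \<open>b\<close>. If the last entry is out of order, it is first swapped
  one place to the left; the smaller entry left behind is a minimum, so one variable drops out, and
  \<open>demazure_polyset\<close> adds it back.\<close>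

lemma key_poly_expansion:
  assumes "weakly_decreasing b \<alpha>"
  shows "key_poly (Suc b) \<alpha> = polyset (expansion b \<alpha>)"
  using assms
proof (induction b arbitrary: \<alpha>)
  case 0
  have "expansion 0 \<alpha> = {\<alpha>}"
    by (auto simp: expansion_def strip_def agree_1 expvec_eq_iff entry_put) metis
  then show ?case
    by (simp add: polyset_def key_poly_dominant weakly_decreasing_def)
next
  case (Suc b)
  show ?case
  proof (cases "entry \<alpha> (Suc (Suc b)) \<le> entry \<alpha> (Suc b)")
    case True
    \<comment> \<open>The truncated difference at position \<open>b + 1\<close> is \<open>0\<close>,
      so the partial sum there cannot exceed that of \<open>\<alpha>\<close>, while every entry up
      to it is at least that of \<open>\<alpha>\<close>.\<close>
    have "\<gamma> = \<alpha>" if "\<gamma> \<in> expansion (Suc b) \<alpha>" for \<gamma>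
    proof -
      have le: "entry \<alpha> j \<le> entry \<gamma> j" if "1 \<le> j" "j \<le> Suc b" for j
        using that \<open>\<gamma> \<in> _\<close> by (auto simp: expansion_def strip_def)
      have sums: "psum \<gamma> (Suc b) \<le> psum \<alpha> (Suc b)" "psum \<gamma> (Suc (Suc b)) = psum \<alpha> (Suc (Suc b))"
        using that True by (auto simp: expansion_def strip_Suc)
      have eq: "entry \<gamma> j = entry \<alpha> j" if "1 \<le> j" "j \<le> Suc b" for j
      proof (rule ccontr)
        assume "entry \<gamma> j \<noteq> entry \<alpha> j"
        then have "psum \<alpha> (Suc b) < psum \<gamma> (Suc b)"
          using le that by (intro sum_strict_mono_ex1) (auto intro!: bexI[of _ j] simp: le_neq_implies_less)
        with sums show False by simp
      qed
      have "psum \<gamma> (Suc b) = psum \<alpha> (Suc b)"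
        using eq by (intro sum.cong) auto
      then have "entry \<gamma> (Suc (Suc b)) = entry \<alpha> (Suc (Suc b))"
        using sums by simp
      show ?thesis
        unfolding expvec_eq_iff
      proof (intro allI)
        fix j
        consider "j = 0 \<or> Suc (Suc b) < j" | "1 \<le> j \<and> j \<le> Suc b" | "j = Suc (Suc b)" by linarith
        then show "entry \<gamma> j = entry \<alpha> j"
          using that eq \<open>entry \<gamma> (Suc (Suc b)) = _\<close> by cases (auto simp: expansion_def agree_def)
      qed
    qed
    then have "expansion (Suc b) \<alpha> = {\<alpha>}"
      by (auto simp: expansion_def strip_def agree_def)
    moreover have "weakly_decreasing (Suc (Suc b)) \<alpha>"
      using Suc.prems True by (simp add: weakly_decreasing_Suc)
    ultimately show ?thesis by (simp add: polyset_def key_poly_dominant)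
  next
    case False
    define c where "c = entry \<alpha> (Suc b)"
    define \<alpha>' where "\<alpha>' = adj (Suc b) \<alpha>"
    have ent: "entry \<alpha>' j = entry \<alpha> j" if "j \<le> b" for j
      using that by (simp add: \<alpha>'_def entry_adj)
    have psum': "psum \<alpha>' j = psum \<alpha> j" if "j \<le> b" for j
      using that by (intro sum.cong) (auto simp: ent)
    have dec: "entry \<alpha> (Suc b) \<le> entry \<alpha> j" if "1 \<le> j" "j \<le> b" for j
      using weakly_decreasingD[OF Suc.prems, of j "Suc b"] that by simp
    have "weakly_decreasing b \<alpha>"
      using Suc.prems by (simp add: weakly_decreasing_Suc)
    then have "weakly_decreasing b \<alpha>'"
      by (rule weakly_decreasing_cong[THEN iffD1, rotated]) (simp add: ent)
    then have IH: "key_poly (Suc b) \<alpha>' = polyset (expansion b \<alpha>')" by (rule Suc.IH)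
    have "is_ascent (Suc (Suc b)) \<alpha> (Suc b)"
      using False by (simp add: is_ascent_iff)
    then have "key_poly (Suc (Suc b)) \<alpha> = demazure (Suc b) (key_poly (Suc (Suc b)) \<alpha>')"
      unfolding \<alpha>'_def by (rule key_poly_ascent)
    also have "key_poly (Suc (Suc b)) \<alpha>' = key_poly (Suc b) \<alpha>'"
    proof (rule key_poly_Suc)
      fix j assume "1 \<le> j" "j \<le> Suc b"
      then show "entry \<alpha>' (Suc (Suc b)) \<le> entry \<alpha>' j"
        using dec[of j] False by (auto simp: \<alpha>'_def entry_adj)
    qed
    also note IH
    also have "demazure (Suc b) (polyset (expansion b \<alpha>')) =
      polyset {\<beta>. c \<le> entry \<beta> (Suc b) \<and> c \<le> entry \<beta> (Suc (Suc b)) \<and> head (Suc b) c \<beta> \<in> expansion b \<alpha>'}"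
    proof (rule demazure_polyset[OF finite_expansion])
      fix \<gamma> assume \<gamma>: "\<gamma> \<in> expansion b \<alpha>'"
      \<comment> \<open>The bound on the partial sum at \<open>b\<close> leaves at least the entry
        of \<open>\<alpha>'\<close> at \<open>b\<close>, or at \<open>b + 1\<close> if that is
        smaller, for position \<open>b + 1\<close>. For \<open>b = 0\<close> the total alone
        decides.\<close>
      have "c \<le> entry \<gamma> (Suc b)"
      proof (cases b)
        case 0
        then show ?thesis
          using \<gamma> False by (auto simp: expansion_def c_def \<alpha>'_def entry_adj)
      next
        case (Suc b')
        then have "psum \<gamma> b \<le> psum \<alpha>' b + (entry \<alpha>' (Suc b) - entry \<alpha>' b)"
          using \<gamma> by (auto simp: expansion_def strip_def)
        moreover have "psum \<gamma> b + entry \<gamma> (Suc b) = psum \<alpha>' b + entry \<alpha>' (Suc b)"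
          using \<gamma> by (auto simp: expansion_def)
        moreover have "c \<le> entry \<alpha>' b" "c \<le> entry \<alpha>' (Suc b)"
          using dec[of b] False Suc by (auto simp: c_def \<alpha>'_def entry_adj)
        ultimately show ?thesis by linarith
      qed
      moreover have "entry \<gamma> (Suc (Suc b)) = c"
        using \<gamma> by (auto simp: expansion_def agree_def c_def \<alpha>'_def entry_adj)
      ultimately show "entry \<gamma> (Suc (Suc b)) = c \<and> c \<le> entry \<gamma> (Suc b)" by simp
    qed
    also have "{\<beta>. c \<le> entry \<beta> (Suc b) \<and> c \<le> entry \<beta> (Suc (Suc b)) \<and> head (Suc b) c \<beta> \<in> expansion b \<alpha>'}
      = expansion (Suc b) \<alpha>"
    proof (rule set_eqI)
      fix \<beta>
      have strip: "head (Suc b) c \<beta> \<in> strip (entry \<alpha>' (Suc b)) b \<alpha>'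
          \<longleftrightarrow> \<beta> \<in> strip (entry \<alpha> (Suc (Suc b))) b \<alpha>"
      proof -
        have "strip M b \<alpha>' = strip M b \<alpha>" for M
          unfolding strip_def using ent psum' by auto
        moreover have "entry \<alpha>' (Suc b) = entry \<alpha> (Suc (Suc b))"
          by (simp add: \<alpha>'_def entry_adj)
        ultimately show ?thesis by (simp add: strip_head)
      qed
      have agree: "head (Suc b) c \<beta> \<in> agree (Suc b) \<alpha>' \<longleftrightarrow> \<beta> \<in> agree (Suc (Suc b)) \<alpha>"
        by (auto simp: agree_def entry_head \<alpha>'_def entry_adj c_def less_Suc_eq)
      have "psum \<alpha>' (Suc b) = psum \<alpha> b + entry \<alpha> (Suc (Suc b))"
        by (simp add: psum' \<alpha>'_def entry_adj)
      then show "\<beta> \<in> {\<beta>. c \<le> entry \<beta> (Suc b) \<and> c \<le> entry \<beta> (Suc (Suc b))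
            \<and> head (Suc b) c \<beta> \<in> expansion b \<alpha>'} \<longleftrightarrow> \<beta> \<in> expansion (Suc b) \<alpha>"
        using False unfolding expansion_def
        by (auto simp: strip[unfolded c_def] agree[unfolded c_def] strip_Suc entry_head c_def)
    qed
    finally show ?thesis .
  qed
qed

text \<open>The induction uses only ascents \<open>i < b\<close>, whose operators preserve sums of
  key polynomials in \<open>b\<close> variables. It ends at indices that decrease up to position
  \<open>b\<close>, where the explicit expansion splits into layers.\<close>

lemma key_poly_branch: "keysum b (\<lambda>_. True) (key_poly (Suc b) \<alpha>)"
proof (induction \<alpha> rule: key_poly_induct[where n = b])
  case (dominant \<alpha>)
  show ?case
  proof (cases "b = 0")
    case True
    then have "key_poly (Suc b) \<alpha> = key_poly b \<alpha>"
      by (simp add: key_poly_Suc)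
    then show ?thesis by (simp add: keysum_single)
  next
    case False
    let ?e = "\<lambda>\<gamma>. entry \<gamma> (Suc b)" and ?E = "expansion b \<alpha>"
    have "keysum b (\<lambda>_. True) (polyset {\<gamma> \<in> ?E. ?e \<gamma> = v})" if v': "v \<in> ?e ` ?E" for v
    proof -
      obtain \<gamma> where \<gamma>: "\<gamma> \<in> ?E" "?e \<gamma> = v" using v' by auto
      have "psum \<alpha> b \<le> psum \<gamma> b"
        using \<gamma> by (intro psum_mono_strip) (auto simp: expansion_def strip_def)
      then have v: "v \<le> ?e \<alpha>"
        using \<gamma> by (auto simp: expansion_def)
      \<comment> \<open>Fixing the last exponent at \<open>v\<close> leaves the surplus
        \<open>?e \<alpha> - v\<close> for the first \<open>b\<close> positions.\<close>
      have "{\<gamma> \<in> ?E. ?e \<gamma> = v} = strip_layer (?e \<alpha>) b (put (Suc b) v \<alpha>) (?e \<alpha> - v)"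
        unfolding expansion_def strip_layer_def using v by (auto simp: agree_put)
      moreover have "weakly_decreasing b (put (Suc b) v \<alpha>)"
        using dominant by (rule weakly_decreasing_cong[THEN iffD1, rotated]) (simp add: entry_put)
      ultimately show ?thesis
        using keysum_strip_layer[of b "put (Suc b) v \<alpha>" "?e \<alpha>" "?e \<alpha> - v"] False
        by (auto intro: keysum_change)
    qed
    then have "keysum b (\<lambda>_. True) (polyset ?E)"
      by (subst polyset_split[where g = ?e]) (auto simp: finite_expansion intro!: keysum_sum)
    then show ?thesis by (simp add: key_poly_expansion[OF dominant])
  qed
next
  case (ascent \<alpha> i)
  have "is_ascent (Suc b) \<alpha> i" using ascent.hyps by (simp add: is_ascent_iff)
  then have "key_poly (Suc b) \<alpha> = demazure i (key_poly (Suc b) (adj i \<alpha>))"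
    by (rule key_poly_ascent)
  then show ?case
    using keysum_demazure[OF ascent.IH(2), of i "\<lambda>_. True"] ascent.hyps by (simp add: is_ascent_iff)
qed

text \<open>Branching reduces the number of variables until a single monomial is left. Positivity
  later excludes cancellation between summands.\<close>

lemma coef_key_poly_nonneg: "0 \<le> coef (key_poly n \<alpha>) \<gamma>"
proof (induction n arbitrary: \<alpha>)
  case 0
  show ?case by (simp add: key_poly_dominant weakly_decreasing_def monomial_def lookup_single when_def)
next
  case (Suc n)
  have "0 \<le> coef f \<gamma>" if "keysum n Q f" for f Q
    using that by (induction rule: keysum.induct) (simp_all add: lookup_add Suc.IH)
  then show ?case using key_poly_branch by blast
qed

lemma coef_keysum_nonneg: "keysum n Q f \<Longrightarrow> 0 \<le> coef f \<gamma>"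
  by (induction rule: keysum.induct) (simp_all add: lookup_add coef_key_poly_nonneg)

section \<open>Strings and the order on compositions\<close>

lemma kappa_step_iff:
  "kappa_step n \<gamma> \<delta> \<longleftrightarrow> (\<exists>p q. 1 \<le> p \<and> p < q \<and> q \<le> n \<and> entry \<gamma> p < entry \<gamma> q \<and>
    (\<forall>k. k \<noteq> p \<and> k \<noteq> q \<longrightarrow> entry \<delta> k = entry \<gamma> k) \<and>
    (entry \<delta> p = entry \<gamma> q \<and> entry \<delta> q = entry \<gamma> p \<or>
     entry \<gamma> p + 1 < entry \<gamma> q \<and> entry \<delta> p = entry \<gamma> p + 1 \<and> entry \<delta> q = entry \<gamma> q - 1))"
  (is "_ \<longleftrightarrow> ?R")
proof
  assume "kappa_step n \<gamma> \<delta>"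
  then show ?R
  proof cases
    case (interchange i j)
    then show ?thesis
      by (intro exI[of _ i] exI[of _ j]) (auto simp: lookup_interchange)
  next
    case (move i j)
    then show ?thesis
      by (intro exI[of _ i] exI[of _ j])
        (auto simp: lookup_add lookup_minus lookup_single when_def)
  qed
next
  assume ?R
  then obtain p q where pq: "1 \<le> p" "p < q" "q \<le> n" "entry \<gamma> p < entry \<gamma> q"
    and other: "\<And>k. k \<noteq> p \<Longrightarrow> k \<noteq> q \<Longrightarrow> entry \<delta> k = entry \<gamma> k"
    and alt: "entry \<delta> p = entry \<gamma> q \<and> entry \<delta> q = entry \<gamma> p \<or>
     entry \<gamma> p + 1 < entry \<gamma> q \<and> entry \<delta> p = entry \<gamma> p + 1 \<and> entry \<delta> q = entry \<gamma> q - 1"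
    by blast
  from alt show "kappa_step n \<gamma> \<delta>"
  proof
    assume "entry \<delta> p = entry \<gamma> q \<and> entry \<delta> q = entry \<gamma> p"
    then have "\<delta> = interchange p q \<gamma>"
      using other by (auto simp: expvec_eq_iff lookup_interchange Transposition.transpose_def)
    then show ?thesis using kappa_step.interchange[of p q n \<gamma>] pq by simp
  next
    assume *: "entry \<gamma> p + 1 < entry \<gamma> q \<and> entry \<delta> p = entry \<gamma> p + 1 \<and> entry \<delta> q = entry \<gamma> q - 1"
    then have "\<delta> = \<gamma> + Poly_Mapping.single p 1 - Poly_Mapping.single q 1"
      using other pq by (auto simp: expvec_eq_iff lookup_add lookup_minus lookup_single when_def)
    then show ?thesis using kappa_step.move[of p q n \<gamma>] pq * by simp
  qed
qed

lemma kappa_step_moveI: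
  assumes "1 \<le> p" "p < q" "q \<le> n" "entry \<gamma> p + 1 < entry \<gamma> q"
    "entry \<delta> p = entry \<gamma> p + 1" "entry \<delta> q = entry \<gamma> q - 1"
    "\<And>k. k \<noteq> p \<Longrightarrow> k \<noteq> q \<Longrightarrow> entry \<delta> k = entry \<gamma> k"
  shows "kappa_step n \<gamma> \<delta>"
  unfolding kappa_step_iff using assms by (intro exI[of _ p] exI[of _ q]) auto

lemma kappa_le_refl [simp]: "kappa_le n \<alpha> \<alpha>"
  by (simp add: kappa_le_def)

lemma kappa_le_trans: "kappa_le n \<alpha> \<beta> \<Longrightarrow> kappa_le n \<beta> \<gamma> \<Longrightarrow> kappa_le n \<alpha> \<gamma>"
  by (simp add: kappa_le_def)

lemma kappa_le_step: "kappa_step n \<alpha> \<beta> \<Longrightarrow> kappa_le n \<beta> \<alpha>"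
  by (simp add: kappa_le_def)

lemma kappa_le_swap:
  assumes "1 \<le> p" "p < q" "q \<le> n" "entry \<gamma> p \<le> entry \<gamma> q"
  shows "kappa_le n (interchange p q \<gamma>) \<gamma>"
proof (cases "entry \<gamma> p = entry \<gamma> q")
  case True
  then have "interchange p q \<gamma> = \<gamma>"
    by (auto simp: expvec_eq_iff lookup_interchange Transposition.transpose_def)
  then show ?thesis by simp
next
  case False
  then show ?thesis
    using assms kappa_step.interchange[of p q n \<gamma>] by (simp add: kappa_le_step)
qed

text \<open>The comparison of the entries at \<open>a\<close> and \<open>a + 1\<close> before and
  after the step gives four cases. The delicate one is where the step turns a weak ascent into a
  descent, so that only the result gets swapped.\<close>

lemma kappa_le_raise:
  assumes a: "1 \<le> a" "a < n" and step: "kappa_step n \<gamma> \<delta>"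
  shows "kappa_le n (raise a \<delta>) (raise a \<gamma>)"
proof -
  obtain p q where pq: "1 \<le> p" "p < q" "q \<le> n" "entry \<gamma> p < entry \<gamma> q"
    and other: "\<And>k. k \<noteq> p \<Longrightarrow> k \<noteq> q \<Longrightarrow> entry \<delta> k = entry \<gamma> k"
    and alt: "entry \<delta> p = entry \<gamma> q \<and> entry \<delta> q = entry \<gamma> p \<or>
     entry \<gamma> p + 1 < entry \<gamma> q \<and> entry \<delta> p = entry \<gamma> p + 1 \<and> entry \<delta> q = entry \<gamma> q - 1"
    using step unfolding kappa_step_iff by blast
  consider (desc) "entry \<gamma> (Suc a) < entry \<gamma> a" "entry \<delta> (Suc a) < entry \<delta> a"
    | (desc_asc) "entry \<gamma> (Suc a) < entry \<gamma> a" "entry \<delta> a \<le> entry \<delta> (Suc a)"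
    | (asc) "entry \<gamma> a \<le> entry \<gamma> (Suc a)" "entry \<delta> a \<le> entry \<delta> (Suc a)"
    | (asc_desc) "entry \<gamma> a \<le> entry \<gamma> (Suc a)" "entry \<delta> (Suc a) < entry \<delta> a"
    by linarith
  then show ?thesis
  proof cases
    case desc
    \<comment> \<open>Both vectors get swapped, so the step is repeated on the relabelled pair. It
      stays in order since \<open>(p, q)\<close> is not \<open>(a, a + 1)\<close>.\<close>
    let ?t = "Transposition.transpose a (Suc a)"
    have eq: "entry (adj a \<zeta>) (?t k) = entry \<zeta> k" for \<zeta> k
      by (simp add: lookup_interchange)
    have "\<not> (p = a \<and> q = Suc a)" using pq(4) desc(1) by auto
    then have tpq: "1 \<le> ?t p" "?t p < ?t q" "?t q \<le> n"
      using pq a by (auto simp: Transposition.transpose_def)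
    have "entry (adj a \<delta>) k = entry (adj a \<gamma>) k" if "k \<noteq> ?t p" "k \<noteq> ?t q" for k
      using other[of "?t k"] that by (metis lookup_interchange transpose_involutory)
    with tpq pq alt have "kappa_step n (adj a \<gamma>) (adj a \<delta>)"
      unfolding kappa_step_iff by (intro exI[of _ "?t p"] exI[of _ "?t q"]) (simp add: eq)
    then show ?thesis using desc by (simp add: raise_def kappa_le_step)
  next
    case desc_asc
    have "kappa_le n (adj a (adj a \<gamma>)) (adj a \<gamma>)"
      using a desc_asc by (intro kappa_le_swap) (auto simp: entry_adj)
    then have "kappa_le n \<gamma> (adj a \<gamma>)" by simp
    then show ?thesis
      using desc_asc kappa_le_step[OF step] kappa_le_trans by (auto simp: raise_def)
  next
    case asc
    then show ?thesis using kappa_le_step[OF step] by (simp add: raise_def)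
  next
    case asc_desc
    \<comment> \<open>A step raises the entry at \<open>p\<close> and lowers that at
      \<open>q\<close>; a new descent at \<open>a\<close> thus needs \<open>p = a\<close> or
      \<open>q = Suc a\<close>.\<close>
    have "p = a \<and> q = Suc a \<or> p = a \<and> Suc a < q \<or> p < a \<and> q = Suc a"
      using asc_desc pq alt other[of a] other[of "Suc a"]
      by (cases "p = a"; cases "q = a"; cases "p = Suc a"; cases "q = Suc a") auto
    from alt have "kappa_le n (adj a \<delta>) \<gamma>"
    proof
      assume swap: "entry \<delta> p = entry \<gamma> q \<and> entry \<delta> q = entry \<gamma> p"
      then have \<delta>: "\<delta> = interchange p q \<gamma>"
        using other by (auto simp: expvec_eq_iff lookup_interchange Transposition.transpose_def)
      from \<open>_ \<or> _ \<or> _\<close> show ?thesis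
      proof (elim disjE conjE)
        assume "p = a" "q = Suc a"
        then show ?thesis by (simp add: \<delta>)
      next
        assume c: "p = a" "Suc a < q"
        \<comment> \<open>The target is reached by two interchanges: first \<open>a\<close> with
          \<open>a + 1\<close>, then \<open>a + 1\<close> with \<open>q\<close>.\<close>
        have "kappa_le n (interchange (Suc a) q (adj a \<gamma>)) (adj a \<gamma>)"
          using c pq by (intro kappa_le_swap) (auto simp: entry_adj)
        moreover have "interchange (Suc a) q (adj a \<gamma>) = adj a \<delta>"
          using c by (auto simp: \<delta> expvec_eq_iff lookup_interchange Transposition.transpose_def)
        moreover have "kappa_le n (adj a \<gamma>) \<gamma>"
          using a asc_desc by (intro kappa_le_swap) auto
        ultimately show ?thesis by (metis kappa_le_trans)
      next
        assume c: "p < a" "q = Suc a"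
        have "kappa_le n (interchange p q (interchange p a \<gamma>)) (interchange p a \<gamma>)"
          using c pq asc_desc
          by (intro kappa_le_swap) (auto simp: lookup_interchange Transposition.transpose_def)
        moreover have "interchange p q (interchange p a \<gamma>) = adj a \<delta>"
          using c by (auto simp: \<delta> expvec_eq_iff lookup_interchange Transposition.transpose_def)
        moreover have "kappa_le n (interchange p a \<gamma>) \<gamma>"
        proof (rule kappa_le_swap)
          have "entry \<delta> a = entry \<gamma> a" "entry \<delta> (Suc a) = entry \<gamma> p"
            using c swap other[of a] by auto
          then show "entry \<gamma> p \<le> entry \<gamma> a" using asc_desc by simp
        qed (use c pq in auto)
        ultimately show ?thesis by (metis kappa_le_trans)
      qed
    next
      assume move: "entry \<gamma> p + 1 < entry \<gamma> q \<and> entry \<delta> p = entry \<gamma> p + 1 \<and> entry \<delta> q = entry \<gamma> q - 1"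
      from \<open>_ \<or> _ \<or> _\<close> show ?thesis
      proof (elim disjE conjE)
        assume "p = a" "q = Suc a"
        then show ?thesis using move asc_desc by auto
      next
        assume c: "p = a" "Suc a < q"
        have "entry \<delta> (Suc a) = entry \<gamma> (Suc a)" using c other by simp
        \<comment> \<open>A unit move creates a descent only if the two entries were equal, and then
          the unit can be added at \<open>a + 1\<close> instead.\<close>
        then have "entry \<gamma> (Suc a) = entry \<gamma> a" using c move asc_desc by simp
        then have "kappa_step n \<gamma> (adj a \<delta>)"
          using c pq move other
          by (intro kappa_step_moveI[of "Suc a" q]) (auto simp: entry_adj)
        then show ?thesis by (rule kappa_le_step)
      next
        assume c: "p < a" "q = Suc a"
        have "entry \<delta> a = entry \<gamma> a" using c other by simp
        then have "entry \<gamma> (Suc a) = entry \<gamma> a" using c move asc_desc by simp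
        then have "kappa_step n \<gamma> (adj a \<delta>)"
          using c pq move other
          by (intro kappa_step_moveI[of p a]) (auto simp: entry_adj)
        then show ?thesis by (rule kappa_le_step)
      qed
    qed
    then show ?thesis using asc_desc by (simp add: raise_def)
  qed
qed

lemma kappa_le_raise_mono:
  assumes "1 \<le> a" "a < n" "kappa_le n \<gamma> \<alpha>"
  shows "kappa_le n (raise a \<gamma>) (raise a \<alpha>)"
  using assms(3) unfolding kappa_le_def[of n \<gamma> \<alpha>]
proof (induction rule: rtranclp_induct)
  case (step \<beta> \<gamma>)
  then show ?case using kappa_le_raise[OF assms(1,2)] kappa_le_trans by blast
qed simp

text \<open>These are the lattice points \<open>\<beta>\<close> of the segment from
  \<open>\<gamma>\<close> to \<open>adj i \<gamma>\<close>.\<close>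

definition on_string :: "nat \<Rightarrow> expvec \<Rightarrow> expvec \<Rightarrow> bool" where
  "on_string i \<gamma> \<beta> \<longleftrightarrow> (\<forall>k. k \<noteq> i \<and> k \<noteq> Suc i \<longrightarrow> entry \<beta> k = entry \<gamma> k) \<and>
    entry \<beta> i + entry \<beta> (Suc i) = entry \<gamma> i + entry \<gamma> (Suc i) \<and>
    min (entry \<gamma> i) (entry \<gamma> (Suc i)) \<le> min (entry \<beta> i) (entry \<beta> (Suc i))"

lemma on_string_adj [simp]:
  "on_string i (adj i \<gamma>) \<beta> \<longleftrightarrow> on_string i \<gamma> \<beta>"
  "on_string i \<gamma> (adj i \<beta>) \<longleftrightarrow> on_string i \<gamma> \<beta>"
  by (auto simp: on_string_def entry_adj min.commute add.commute)

lemma on_string_refl [simp]: "on_string i \<gamma> \<gamma>"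
  by (simp add: on_string_def)

text \<open>From the ascending end of the string, unit moves reach every point up to the middle; one
  interchange reflects these to the other half.\<close>

lemma kappa_le_on_string:
  assumes a: "1 \<le> a" "a < n" and "on_string a \<gamma> \<beta>"
  shows "kappa_le n \<beta> (raise a \<gamma>)"
proof -
  have half: "kappa_le n \<beta> \<gamma>"
    if "on_string a \<gamma> \<beta>" "entry \<gamma> a \<le> entry \<gamma> (Suc a)" "entry \<beta> a \<le> entry \<beta> (Suc a)" for \<gamma> \<beta>
    using that
  proof (induction "entry \<beta> a - entry \<gamma> a" arbitrary: \<beta>)
    case 0
    then have "\<beta> = \<gamma>"
      unfolding expvec_eq_iff on_string_def by (metis add_left_cancel diff_is_0_eq le_antisym min_def)
    then show ?case by simp
  next
    case (Suc k)
    \<comment> \<open>The neighbour of \<open>\<beta>\<close> one unit further from the middle, from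
      which a move leads to \<open>\<beta>\<close>.\<close>
    define \<beta>' where "\<beta>' = put a (entry \<beta> a - 1) (put (Suc a) (entry \<beta> (Suc a) + 1) \<beta>)"
    have "kappa_step n \<beta>' \<beta>"
      using a Suc.hyps(2) Suc.prems
      by (intro kappa_step_moveI[of a "Suc a"]) (auto simp: \<beta>'_def entry_put)
    moreover have "kappa_le n \<beta>' \<gamma>"
      using Suc.hyps(2) Suc.prems
      by (intro Suc.hyps(1)) (auto simp: \<beta>'_def entry_put on_string_def)
    ultimately show ?case using kappa_le_step kappa_le_trans by blast
  qed
  have full: "kappa_le n \<beta> \<gamma>" if "on_string a \<gamma> \<beta>" "entry \<gamma> a \<le> entry \<gamma> (Suc a)" for \<gamma>
  proof (cases "entry \<beta> a \<le> entry \<beta> (Suc a)")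
    case True
    then show ?thesis using half that by blast
  next
    case False
    have "kappa_le n (adj a \<beta>) \<gamma>"
      using that False by (intro half) (auto simp: entry_adj)
    moreover have "kappa_le n (adj a (adj a \<beta>)) (adj a \<beta>)"
      using a False by (intro kappa_le_swap) (auto simp: entry_adj)
    ultimately show ?thesis using kappa_le_trans by (metis interchange_interchange)
  qed
  show ?thesis
    using assms by (auto simp: raise_def entry_adj intro!: full)
qed

lemma kappa_le_string_closed:
  assumes "1 \<le> a" "a < n" "kappa_le n \<gamma> \<alpha>" "on_string a \<gamma> \<beta>"
  shows "kappa_le n \<beta> (raise a \<alpha>)"
  using kappa_le_on_string[OF assms(1,2,4)] kappa_le_raise_mono[OF assms(1-3)]
  by (rule kappa_le_trans)

section \<open>Supports of Demazure images\<close>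

lemma monomial_single: "Poly_Mapping.single \<gamma> c = Poly_Mapping.single 0 c * monomial \<gamma>"
  by (simp add: monomial_def mult_single)

lemma demazure_const_mult:
  "demazure i (Poly_Mapping.single 0 c * f) = Poly_Mapping.single 0 c * demazure i f"
proof (rule demazure_unique)
  have "interchange i (i + 1) 0 = 0"
    by (simp add: expvec_eq_iff lookup_interchange)
  then have "swap_vars i (Poly_Mapping.single 0 c) = Poly_Mapping.single 0 c"
    by (simp only: swap_vars_single)
  then have "swap_vars i (Poly_Mapping.single 0 c * f) = Poly_Mapping.single 0 c * swap_vars i f"
    by (simp only: swap_vars_mult)
  moreover have "(var i - var (Suc i)) * (Poly_Mapping.single 0 c * demazure i f)
      = Poly_Mapping.single 0 c * (var i * f - var (Suc i) * swap_vars i f)"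
    unfolding demazure_mult[symmetric] by (rule mult.left_commute)
  ultimately show "(var i - var (Suc i)) * (Poly_Mapping.single 0 c * demazure i f)
      = var i * (Poly_Mapping.single 0 c * f)
        - var (Suc i) * swap_vars i (Poly_Mapping.single 0 c * f)"
    by (simp only: right_diff_distrib mult.left_commute)
qed

lemma keys_const_mult: "Poly_Mapping.keys (Poly_Mapping.single 0 c * f :: expvec \<Rightarrow>\<^sub>0 int) \<subseteq> Poly_Mapping.keys f"
  using keys_mult[of "Poly_Mapping.single 0 c" f] by (auto split: if_splits)

lemma keys_demazure_monomial:
  assumes "\<beta> \<in> Poly_Mapping.keys (demazure i (monomial \<gamma>))"
  shows "on_string i \<gamma> \<beta>"
proof -
  have dec: "on_string i \<gamma> \<beta>"
    if le: "entry \<gamma> (Suc i) \<le> entry \<gamma> i"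
      and key: "\<beta> \<in> Poly_Mapping.keys (demazure i (monomial \<gamma>))" for \<gamma>
  proof -
    have "coef (demazure i (monomial \<gamma>)) \<beta>
        = (\<Sum>k\<le>entry \<gamma> i - entry \<gamma> (Suc i). coef (monomial (slide i k \<gamma>)) \<beta>)"
      by (simp add: demazure_monomial[OF le] coef_sum)
    then obtain k where "k \<le> entry \<gamma> i - entry \<gamma> (Suc i)" "coef (monomial (slide i k \<gamma>)) \<beta> \<noteq> 0"
      using key by (metis (no_types, lifting) atMost_iff in_keys_iff sum.not_neutral_contains_not_neutral)
    then have "\<beta> = slide i k \<gamma>" "k \<le> entry \<gamma> i - entry \<gamma> (Suc i)"
      by (auto simp: monomial_def lookup_single when_def split: if_splits)
    then show ?thesis
      using le by (auto simp: on_string_def entry_slide)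
  qed
  show ?thesis
  proof (cases "entry \<gamma> (Suc i) \<le> entry \<gamma> i")
    case True
    then show ?thesis using dec assms by blast
  next
    case False
    have swap: "swap_vars i (monomial \<delta>) = monomial (adj i \<delta>)" for \<delta>
      by (simp add: monomial_def swap_vars_single)
    \<comment> \<open>The symmetric sum is fixed by the operator, which reduces an ascending
      \<open>\<gamma>\<close> to its reflection. Signs are harmless, as only an upper bound for the
      support is wanted.\<close>
    have "demazure i (monomial \<gamma> + monomial (adj i \<gamma>)) = monomial \<gamma> + monomial (adj i \<gamma>)"
      by (rule demazure_symmetric) (simp add: swap_vars_add swap add.commute)
    then have "demazure i (monomial \<gamma>)
        = monomial \<gamma> + monomial (adj i \<gamma>) - demazure i (monomial (adj i \<gamma>))"
      by (simp add: demazure_add algebra_simps)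
    then have "\<beta> = \<gamma> \<or> \<beta> = adj i \<gamma> \<or> \<beta> \<in> Poly_Mapping.keys (demazure i (monomial (adj i \<gamma>)))"
      using assms
      by (auto simp: in_keys_iff lookup_add lookup_minus monomial_def lookup_single when_def
          split: if_splits)
    then show ?thesis
      using dec[of "adj i \<gamma>"] False by (auto simp: entry_adj)
  qed
qed

lemma keys_demazure:
  assumes "\<beta> \<in> Poly_Mapping.keys (demazure i f)"
  shows "\<exists>\<gamma>\<in>Poly_Mapping.keys f. on_string i \<gamma> \<beta>"
proof -
  have "f = (\<Sum>\<gamma>\<in>Poly_Mapping.keys f. Poly_Mapping.single 0 (coef f \<gamma>) * monomial \<gamma>)"
    unfolding monomial_single[symmetric]
    by (rule poly_mapping_eqI) (auto simp: coef_sum lookup_single when_def in_keys_iff)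
  then have "demazure i f
      = (\<Sum>\<gamma>\<in>Poly_Mapping.keys f. Poly_Mapping.single 0 (coef f \<gamma>) * demazure i (monomial \<gamma>))"
    by (metis (no_types, lifting) demazure_const_mult demazure_sum sum.cong)
  then have "coef (demazure i f) \<beta>
      = (\<Sum>\<gamma>\<in>Poly_Mapping.keys f. coef (Poly_Mapping.single 0 (coef f \<gamma>) * demazure i (monomial \<gamma>)) \<beta>)"
    by (simp add: coef_sum)
  moreover have "coef (demazure i f) \<beta> \<noteq> 0"
    using assms by (simp add: in_keys_iff)
  ultimately obtain \<gamma> where "\<gamma> \<in> Poly_Mapping.keys f"
    "coef (Poly_Mapping.single 0 (coef f \<gamma>) * demazure i (monomial \<gamma>)) \<beta> \<noteq> 0"
    by (metis (no_types, lifting) sum.not_neutral_contains_not_neutral)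
  moreover from this(2) have "\<beta> \<in> Poly_Mapping.keys (demazure i (monomial \<gamma>))"
    using keys_const_mult by (metis in_keys_iff subsetD)
  ultimately show ?thesis using keys_demazure_monomial by blast
qed

text \<open>At an ascent \<open>i\<close> one has
  \<open>raise i (adj i \<alpha>) = \<alpha>\<close>, so strings through vectors below
  \<open>adj i \<alpha>\<close> stay below \<open>\<alpha>\<close>.\<close>

lemma keys_key_poly_kappa_le: "\<beta> \<in> Poly_Mapping.keys (key_poly n \<alpha>) \<Longrightarrow> kappa_le n \<beta> \<alpha>"
proof (induction \<alpha> arbitrary: \<beta> rule: key_poly_induct[where n = n])
  case (dominant \<alpha>)
  then show ?case by (simp add: key_poly_dominant monomial_def)
next
  case (ascent \<alpha> i)
  obtain \<gamma> where "\<gamma> \<in> Poly_Mapping.keys (key_poly n (adj i \<alpha>))" "on_string i \<gamma> \<beta>"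
    using ascent.prems keys_demazure unfolding key_poly_ascent[OF ascent.hyps] by blast
  then have "kappa_le n \<beta> (raise i (adj i \<alpha>))"
    using ascent.hyps by (intro kappa_le_string_closed[OF _ _ ascent.IH(2)]) (auto simp: is_ascent_iff)
  then show ?case using ascent.hyps by (simp add: raise_def entry_adj is_ascent_iff)
qed

section \<open>The polytope of a key polynomial\<close>

text \<open>By Koenig's theorem this is the largest number of pairs \<open>k \<le> d\<close> with \<open>k \<in> I\<close> and \<open>d \<in> D\<close>
  that are disjoint, i.e. the rank of \<open>I\<close> in the Schubert matroid of \<open>D\<close>.\<close>

definition match_rank :: "nat set \<Rightarrow> nat set \<Rightarrow> nat" where
  "match_rank I D = (INF t. card (I \<inter> {..<t}) + card (D \<inter> {t..}))"

lemma match_rank_le: "match_rank I D \<le> card (I \<inter> {..<t}) + card (D \<inter> {t..})"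
  unfolding match_rank_def by (rule cINF_lower) auto

lemma match_rank_attained:
  obtains t where "match_rank I D = card (I \<inter> {..<t}) + card (D \<inter> {t..})"
proof -
  have "match_rank I D \<in> range (\<lambda>t. card (I \<inter> {..<t}) + card (D \<inter> {t..}))"
    unfolding match_rank_def by (rule Inf_nat_def1) simp
  then show ?thesis using that by blast
qed

lemma match_rank_mono_cut:
  assumes "\<And>t. card (I \<inter> {..<t}) + card (D \<inter> {t..}) \<le> card (I' \<inter> {..<t}) + card (D' \<inter> {t..})"
  shows "match_rank I D \<le> match_rank I' D'"
  using match_rank_attained match_rank_le assms by (metis le_trans)

lemma card_Int_lessThan_Suc:
  "finite A \<Longrightarrow> card (A \<inter> {..<Suc t}) = card (A \<inter> {..<t}) + (if t \<in> A then 1 else 0)"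
  by (simp add: lessThan_Suc Int_insert_right)

lemma card_Int_atLeast:
  assumes "finite A"
  shows "card (A \<inter> {t..}) = card (A \<inter> {Suc t..}) + (if t \<in> A then 1 else 0)"
proof -
  have "{t..} = insert t {Suc t..}" by auto
  then show ?thesis using assms by (simp add: Int_insert_right)
qed

lemma card_insert_atLeast_le:
  fixes E :: "nat set"
  assumes "finite E" "p \<le> q" "p \<notin> E" "q \<notin> E"
  shows "card (insert p E \<inter> {t..}) \<le> card (insert q E \<inter> {t..})"
  using assms le_trans[of t p q] by (simp add: Int_insert_left)

lemma card_insert_lessThan_le:
  fixes E :: "nat set"
  assumes "finite E" "p \<le> q" "p \<notin> E" "q \<notin> E"
  shows "card (insert q E \<inter> {..<t}) \<le> card (insert p E \<inter> {..<t})"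
  using assms le_less_trans[of p q t] by (simp add: Int_insert_left)

lemma match_rank_insert_right_mono:
  assumes "finite E" "p \<le> q" "p \<notin> E" "q \<notin> E"
  shows "match_rank I (insert p E) \<le> match_rank I (insert q E)"
  using card_insert_atLeast_le[OF assms] by (intro match_rank_mono_cut) simp

lemma match_rank_insert_left_mono:
  assumes "finite E" "p \<le> q" "p \<notin> E" "q \<notin> E"
  shows "match_rank (insert q E) D \<le> match_rank (insert p E) D"
  using card_insert_lessThan_le[OF assms] by (intro match_rank_mono_cut) simp

lemma match_rank_mono: "finite J \<Longrightarrow> I \<subseteq> J \<Longrightarrow> match_rank I D \<le> match_rank J D"
  by (intro match_rank_mono_cut add_right_mono card_mono) auto

text \<open>Adding \<open>p\<close> gains no more over the larger set \<open>D\<close> than over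
  \<open>E\<close>. Cuts \<open>s\<close> and \<open>t\<close> attaining the right side are reused
  on the left, and exchanged if \<open>p\<close> lies between them.\<close>

lemma match_rank_submodular_right:
  assumes "finite D" "E \<subseteq> D" "p \<notin> D"
  shows "match_rank I (insert p D) + match_rank I E \<le> match_rank I D + match_rank I (insert p E)"
proof -
  obtain s where s: "match_rank I D = card (I \<inter> {..<s}) + card (D \<inter> {s..})"
    by (rule match_rank_attained)
  obtain t where t: "match_rank I (insert p E) = card (I \<inter> {..<t}) + card (insert p E \<inter> {t..})"
    by (rule match_rank_attained)
  note le = match_rank_le[of I "insert p D"] match_rank_le[of I E]
  have fin: "finite E" "p \<notin> E" using assms finite_subset by auto
  consider "p < s" | "s \<le> p" "t \<le> p" | "s \<le> p" "p < t" by linarith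
  then show ?thesis
  proof cases
    case 1
    have "card (E \<inter> {t..}) \<le> card (insert p E \<inter> {t..})"
      using fin by (intro card_mono) auto
    then show ?thesis using le(1)[of s] le(2)[of t] s t 1 by simp
  next
    case 2
    then show ?thesis using le(1)[of s] le(2)[of t] s t assms fin by simp
  next
    case 3
    have split: "card (A \<inter> {s..}) = card (A \<inter> {t..}) + card (A \<inter> {s..<t})" if "finite A" for A :: "nat set"
    proof -
      have "A \<inter> {s..} = (A \<inter> {t..}) \<union> (A \<inter> {s..<t})" using 3 by auto
      then show ?thesis using that by (simp add: card_Un_disjoint disjoint_iff)
    qed
    have "card (E \<inter> {s..<t}) \<le> card (D \<inter> {s..<t})"
      using assms by (intro card_mono) auto
    then show ?thesis
      using le(1)[of t] le(2)[of s] s t 3 split[OF assms(1)] split[OF fin(1)] by simp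
  qed
qed

text \<open>Submodularity of a matroid rank: of two optimal cuts, the smaller one serves the union
  and the larger one the intersection.\<close>

lemma match_rank_submodular_left:
  assumes fin: "finite I" "finite J"
  shows "match_rank (I \<union> J) D + match_rank (I \<inter> J) D \<le> match_rank I D + match_rank J D"
proof -
  have main: "match_rank (I \<union> J) D + match_rank (I \<inter> J) D
      \<le> (card (I \<inter> {..<s}) + card (D \<inter> {s..})) + (card (J \<inter> {..<t}) + card (D \<inter> {t..}))"
    if "s \<le> t" "finite I" "finite J" for I J s t
  proof -
    have split: "card (A \<inter> {..<t}) = card (A \<inter> {..<s}) + card (A \<inter> {s..<t})" if "finite A" for A :: "nat set"
    proof -
      have "A \<inter> {..<t} = (A \<inter> {..<s}) \<union> (A \<inter> {s..<t})" using \<open>s \<le> t\<close> by auto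
      then show ?thesis using that by (simp add: card_Un_disjoint disjoint_iff)
    qed
    have "card ((I \<union> J) \<inter> {..<s}) + card ((I \<inter> J) \<inter> {..<s}) = card (I \<inter> {..<s}) + card (J \<inter> {..<s})"
    proof -
      have "(I \<inter> {..<s}) \<union> (J \<inter> {..<s}) = (I \<union> J) \<inter> {..<s}"
        "(I \<inter> {..<s}) \<inter> (J \<inter> {..<s}) = (I \<inter> J) \<inter> {..<s}" by auto
      then show ?thesis using card_Un_Int[of "I \<inter> {..<s}" "J \<inter> {..<s}"] that by simp
    qed
    moreover have "card ((I \<inter> J) \<inter> {s..<t}) \<le> card (J \<inter> {s..<t})"
      using that by (intro card_mono) auto
    ultimately show ?thesis
      using match_rank_le[of "I \<union> J" D s] match_rank_le[of "I \<inter> J" D t]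
        split[of "I \<inter> J"] split[of J] that by simp
  qed
  obtain s where s: "match_rank I D = card (I \<inter> {..<s}) + card (D \<inter> {s..})"
    by (rule match_rank_attained)
  obtain t where t: "match_rank J D = card (J \<inter> {..<t}) + card (D \<inter> {t..})"
    by (rule match_rank_attained)
  show ?thesis
  proof (cases "s \<le> t")
    case True
    then show ?thesis using main[of s t I J] fin s t by simp
  next
    case False
    then show ?thesis using main[of t s J I] fin s t by (simp add: Un_commute Int_commute)
  qed
qed

text \<open>Only the cut \<open>t = Suc i\<close> separates \<open>i\<close> from
  \<open>i + 1\<close>. It can be replaced by \<open>i\<close> when \<open>i \<in> I\<close>, and by
  \<open>i + 2\<close> when \<open>Suc i \<notin> I\<close>.\<close>

lemma match_rank_shift_right:
  assumes "finite I" "finite E" "i \<notin> E" "Suc i \<notin> E" "i \<in> I \<or> Suc i \<notin> I"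
  shows "match_rank I (insert (Suc i) E) \<le> match_rank I (insert i E)"
proof -
  obtain t where t: "match_rank I (insert i E) = card (I \<inter> {..<t}) + card (insert i E \<inter> {t..})"
    by (rule match_rank_attained)
  note le = match_rank_le[of I "insert (Suc i) E"]
  show ?thesis
  proof (cases "t = Suc i")
    case False
    then have "card (insert i E \<inter> {t..}) = card (insert (Suc i) E \<inter> {t..})"
      using assms by (auto simp: Int_insert_left)
    then show ?thesis using t le[of t] by simp
  next
    case True
    from assms(5) show ?thesis
    proof
      assume "i \<in> I"
      then show ?thesis
        using t le[of i] assms True card_Int_lessThan_Suc[of I i]
          card_Int_atLeast[of "insert (Suc i) E" i] by (simp add: Int_insert_left)
    next
      assume "Suc i \<notin> I"
      then show ?thesis
        using t le[of "Suc (Suc i)"] assms True card_Int_lessThan_Suc[of I "Suc i"]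
          card_Int_atLeast[of E "Suc i"] by (simp add: Int_insert_left)
    qed
  qed
qed

text \<open>As before only the cut \<open>t = Suc i\<close> matters; it is replaced by
  \<open>i\<close> or by \<open>i + 2\<close> according to whether \<open>i\<close> is missing from
  \<open>D\<close> or not.\<close>

lemma match_rank_shift_left:
  assumes "finite J" "finite D" "i \<notin> J" "Suc i \<notin> J" "i \<in> D \<longrightarrow> Suc i \<in> D"
  shows "match_rank (insert i J) D \<le> match_rank (insert (Suc i) J) D"
proof -
  obtain t where t: "match_rank (insert (Suc i) J) D
      = card (insert (Suc i) J \<inter> {..<t}) + card (D \<inter> {t..})"
    by (rule match_rank_attained)
  note le = match_rank_le[of "insert i J" D]
  show ?thesis
  proof (cases "t = Suc i")
    case False
    then have "card (insert i J \<inter> {..<t}) = card (insert (Suc i) J \<inter> {..<t})"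
      using assms by (auto simp: Int_insert_left)
    then show ?thesis using t le[of t] by simp
  next
    case True
    show ?thesis
    proof (cases "i \<in> D")
      case False
      then show ?thesis
        using t le[of i] assms True card_Int_lessThan_Suc[of J i] card_Int_atLeast[of D i]
        by (simp add: Int_insert_left)
    next
      case D: True
      then show ?thesis
        using t le[of "Suc (Suc i)"] assms True card_Int_lessThan_Suc[of J "Suc i"]
          card_Int_atLeast[of D "Suc i"] by (simp add: Int_insert_left)
    qed
  qed
qed

section \<open>The bound \<open>theta\<close> and its monotonicity along the order\<close>

definition level :: "nat \<Rightarrow> expvec \<Rightarrow> nat \<Rightarrow> nat set" where
  "level n \<alpha> c = {j \<in> {1..n}. c \<le> entry \<alpha> j}"

lemma finite_level [simp]: "finite (level n \<alpha> c)"
  by (simp add: level_def)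

text \<open>Each \<open>level n \<alpha> c\<close> is a column of the diagram of
  \<open>\<alpha>\<close>. \<open>N\<close> stands for a bound on the entries, so that the sum meets
  every nonempty column.\<close>

definition theta :: "nat \<Rightarrow> nat \<Rightarrow> expvec \<Rightarrow> nat set \<Rightarrow> nat" where
  "theta N n \<alpha> I = (\<Sum>c=1..N. match_rank I (level n \<alpha> c))"

abbreviation bounded_by :: "nat \<Rightarrow> nat \<Rightarrow> expvec \<Rightarrow> bool" where
  "bounded_by N n \<alpha> \<equiv> \<forall>j\<in>{1..n}. entry \<alpha> j \<le> N"

lemma sum_card_level:
  assumes "I \<subseteq> {1..n}" "bounded_by N n \<alpha>"
  shows "(\<Sum>c=1..N. card (I \<inter> level n \<alpha> c)) = (\<Sum>k\<in>I. entry \<alpha> k)"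
proof -
  have fin: "finite I" using assms(1) finite_subset by blast
  have "card (I \<inter> level n \<alpha> c) = (\<Sum>k\<in>I. if c \<le> entry \<alpha> k then 1 else 0)" for c
  proof -
    have "I \<inter> level n \<alpha> c = {k \<in> I. c \<le> entry \<alpha> k}" using assms(1) by (auto simp: level_def)
    then show ?thesis using fin by (simp add: sum.If_cases Int_def)
  qed
  then have "(\<Sum>c=1..N. card (I \<inter> level n \<alpha> c)) = (\<Sum>c=1..N. \<Sum>k\<in>I. if c \<le> entry \<alpha> k then 1 else 0)"
    by simp
  also have "\<dots> = (\<Sum>k\<in>I. \<Sum>c=1..N. if c \<le> entry \<alpha> k then 1 else 0)"
    by (rule sum.swap)
  also have "\<dots> = (\<Sum>k\<in>I. entry \<alpha> k)"
  proof (rule sum.cong)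
    fix k assume "k \<in> I"
    then have "{1..N} \<inter> {c. c \<le> entry \<alpha> k} = {1..entry \<alpha> k}" using assms by fastforce
    then show "(\<Sum>c=1..N. if c \<le> entry \<alpha> k then 1 else 0) = entry \<alpha> k"
      by (simp add: sum.If_cases)
  qed simp
  finally show ?thesis .
qed

definition keytope :: "nat \<Rightarrow> nat \<Rightarrow> expvec \<Rightarrow> expvec set" where
  "keytope N n \<alpha> = {\<beta> \<in> agree n \<alpha>. psum \<beta> n = psum \<alpha> n \<and>
    (\<forall>I\<subseteq>{1..n}. (\<Sum>k\<in>I. entry \<beta> k) \<le> theta N n \<alpha> I)}"

text \<open>In each column, every cut \<open>t\<close> covers \<open>I \<inter> D\<close> by the
  part of \<open>I\<close> below \<open>t\<close> and the part of \<open>D\<close> from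
  \<open>t\<close> on. Summing over the columns counts the entries in \<open>I\<close>.\<close>

lemma sum_entry_le_theta:
  assumes "I \<subseteq> {1..n}" "bounded_by N n \<alpha>"
  shows "(\<Sum>k\<in>I. entry \<alpha> k) \<le> theta N n \<alpha> I"
proof -
  have fin: "finite I" using assms(1) finite_subset by blast
  have "card (I \<inter> D) \<le> match_rank I D" if "finite D" for D
  proof -
    obtain t where t: "match_rank I D = card (I \<inter> {..<t}) + card (D \<inter> {t..})"
      by (rule match_rank_attained)
    have "card (I \<inter> D) \<le> card ((I \<inter> {..<t}) \<union> (D \<inter> {t..}))"
      using fin that by (intro card_mono) auto
    also have "\<dots> \<le> card (I \<inter> {..<t}) + card (D \<inter> {t..})" by (rule card_Un_le)
    finally show ?thesis using t by simp
  qed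
  then show ?thesis
    unfolding theta_def sum_card_level[OF assms, symmetric] by (intro sum_mono) simp
qed

text \<open>An interchange replaces \<open>q\<close> by \<open>p < q\<close> in some columns, each
  of which loses rank weakly. A unit move changes two columns, which must be compared together by
  submodularity.\<close>

lemma theta_step:
  assumes step: "kappa_step n \<gamma> \<delta>" and N: "bounded_by N n \<gamma>"
  shows "theta N n \<delta> I \<le> theta N n \<gamma> I"
proof -
  obtain p q where pq: "1 \<le> p" "p < q" "q \<le> n" "entry \<gamma> p < entry \<gamma> q"
    and other: "\<And>k. k \<noteq> p \<Longrightarrow> k \<noteq> q \<Longrightarrow> entry \<delta> k = entry \<gamma> k"
    and alt: "entry \<delta> p = entry \<gamma> q \<and> entry \<delta> q = entry \<gamma> p \<or>
     entry \<gamma> p + 1 < entry \<gamma> q \<and> entry \<delta> p = entry \<gamma> p + 1 \<and> entry \<delta> q = entry \<gamma> q - 1"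
    using step unfolding kappa_step_iff by blast
  have mem: "j \<in> level n \<zeta> c \<longleftrightarrow> 1 \<le> j \<and> j \<le> n \<and> c \<le> entry \<zeta> j" for \<zeta> c j
    by (simp add: level_def)
  from alt show ?thesis
  proof
    assume swap: "entry \<delta> p = entry \<gamma> q \<and> entry \<delta> q = entry \<gamma> p"
    have "match_rank I (level n \<delta> c) \<le> match_rank I (level n \<gamma> c)" for c
    proof (cases "entry \<gamma> p < c \<and> c \<le> entry \<gamma> q")
      case True
      define E where "E = level n \<gamma> c - {p, q}"
      have "level n \<gamma> c = insert q E" "level n \<delta> c = insert p E"
        unfolding set_eq_iff E_def insert_iff Diff_iff mem using True pq swap other
        by (metis empty_iff insert_iff le_trans less_imp_le not_le)+
      moreover have "match_rank I (insert p E) \<le> match_rank I (insert q E)"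
        using pq by (intro match_rank_insert_right_mono) (auto simp: E_def)
      ultimately show ?thesis by simp
    next
      case False
      have "c \<le> entry \<delta> j \<longleftrightarrow> c \<le> entry \<gamma> j" for j
        using False pq(4) swap other[of j] by (cases "j = p"; cases "j = q") auto
      then have "level n \<delta> c = level n \<gamma> c"
        by (simp add: level_def)
      then show ?thesis by simp
    qed
    then show ?thesis unfolding theta_def by (rule sum_mono)
  next
    assume move: "entry \<gamma> p + 1 < entry \<gamma> q \<and> entry \<delta> p = entry \<gamma> p + 1 \<and> entry \<delta> q = entry \<gamma> q - 1"
    \<comment> \<open>The only two columns that change: \<open>c\<close> gains \<open>p\<close> and
      \<open>d\<close> loses \<open>q\<close>. They differ because the move requires a gap of at
      least two.\<close>
    define c d where "c = entry \<gamma> p + 1" and "d = entry \<gamma> q"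
    define E where "E = level n \<gamma> d - {q}"
    have cd: "c \<in> {1..N}" "d \<in> {1..N} - {c}"
    proof -
      have "entry \<gamma> q \<le> N" using N pq by auto
      then show "c \<in> {1..N}" "d \<in> {1..N} - {c}" using move by (auto simp: c_def d_def)
    qed
    have same: "level n \<delta> e = level n \<gamma> e" if "e \<noteq> c" "e \<noteq> d" for e
    proof -
      have "e \<le> entry \<delta> j \<longleftrightarrow> e \<le> entry \<gamma> j" for j
        using that move other[of j] by (cases "j = p"; cases "j = q") (auto simp: c_def d_def)
      then show ?thesis by (simp add: level_def)
    qed
    have E: "level n \<delta> d = E"
    proof -
      have "d \<le> entry \<delta> j \<longleftrightarrow> d \<le> entry \<gamma> j \<and> j \<noteq> q" for j
        using pq move other[of j] by (cases "j = p"; cases "j = q") (auto simp: d_def)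
      then show ?thesis by (auto simp: E_def level_def)
    qed
    have qE: "level n \<gamma> d = insert q E"
      using pq by (auto simp: E_def level_def d_def)
    have pD: "level n \<delta> c = insert p (level n \<gamma> c)"
    proof -
      have "c \<le> entry \<delta> j \<longleftrightarrow> c \<le> entry \<gamma> j \<or> j = p" for j
        using pq move other[of j] by (cases "j = p"; cases "j = q") (auto simp: c_def)
      then show ?thesis using pq by (auto simp: level_def)
    qed
    have "E \<subseteq> level n \<gamma> c" using move by (auto simp: E_def level_def c_def d_def)
    moreover have p: "p \<notin> level n \<gamma> c" by (simp add: level_def c_def)
    ultimately have "match_rank I (insert p (level n \<gamma> c)) + match_rank I E
        \<le> match_rank I (level n \<gamma> c) + match_rank I (insert p E)"
      by (intro match_rank_submodular_right) auto
    also have "match_rank I (insert p E) \<le> match_rank I (insert q E)"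
      using pq p \<open>E \<subseteq> _\<close> by (intro match_rank_insert_right_mono) (auto simp: E_def)
    finally have two: "match_rank I (level n \<delta> c) + match_rank I (level n \<delta> d)
        \<le> match_rank I (level n \<gamma> c) + match_rank I (level n \<gamma> d)"
      by (simp add: E qE pD)
    have split: "theta N n \<zeta> I = match_rank I (level n \<zeta> c) + (match_rank I (level n \<zeta> d)
        + (\<Sum>e\<in>{1..N} - {c} - {d}. match_rank I (level n \<zeta> e)))" for \<zeta>
      unfolding theta_def using cd by (subst sum.remove[of _ c], simp, simp, subst sum.remove[of _ d]) auto
    have "(\<Sum>e\<in>{1..N} - {c} - {d}. match_rank I (level n \<delta> e))
        = (\<Sum>e\<in>{1..N} - {c} - {d}. match_rank I (level n \<gamma> e))"
      by (intro sum.cong) (auto simp: same)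
    then show ?thesis unfolding split using two by simp
  qed
qed

lemma sum_two:
  fixes f g :: "nat \<Rightarrow> nat"
  assumes "finite A" "p \<in> A" "q \<in> A" "p \<noteq> q" "f p + f q = g p + g q"
    "\<And>k. k \<noteq> p \<Longrightarrow> k \<noteq> q \<Longrightarrow> f k = g k"
  shows "(\<Sum>k\<in>A. f k) = (\<Sum>k\<in>A. g k)"
proof -
  have split: "(\<Sum>k\<in>A. h k) = h p + h q + (\<Sum>k\<in>A - {p} - {q}. h k)" for h :: "nat \<Rightarrow> nat"
    using assms by (subst sum.remove[of _ p], simp, simp, subst sum.remove[of _ q]) auto
  have "(\<Sum>k\<in>A - {p} - {q}. f k) = (\<Sum>k\<in>A - {p} - {q}. g k)"
    by (intro sum.cong) (auto intro: assms(6))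
  then show ?thesis unfolding split using assms(5) by simp
qed

text \<open>A vector satisfies its own bound \<open>theta\<close>, which is at most that of
  \<open>\<alpha>\<close>. Steps also preserve the bound \<open>N\<close>, so
  \<open>theta_step\<close> can be iterated.\<close>

lemma kappa_le_keytope:
  assumes "kappa_le n \<beta> \<alpha>" "bounded_by N n \<alpha>"
  shows "\<beta> \<in> keytope N n \<alpha>"
proof -
  have "bounded_by N n \<beta> \<and> \<beta> \<in> agree n \<alpha> \<and> psum \<beta> n = psum \<alpha> n \<and>
      (\<forall>I. theta N n \<beta> I \<le> theta N n \<alpha> I)"
    using assms(1) unfolding kappa_le_def
  proof (induction rule: rtranclp_induct)
    case base
    show ?case using assms(2) by (simp add: agree_def)
  next
    case (step \<gamma> \<delta>)
    have *: "theta N n \<delta> I \<le> theta N n \<gamma> I" for I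
      using theta_step step by blast
    obtain p q where pq: "1 \<le> p" "p < q" "q \<le> n" "entry \<gamma> p < entry \<gamma> q"
      and other: "\<And>k. k \<noteq> p \<Longrightarrow> k \<noteq> q \<Longrightarrow> entry \<delta> k = entry \<gamma> k"
      and alt: "entry \<delta> p = entry \<gamma> q \<and> entry \<delta> q = entry \<gamma> p \<or>
       entry \<gamma> p + 1 < entry \<gamma> q \<and> entry \<delta> p = entry \<gamma> p + 1 \<and> entry \<delta> q = entry \<gamma> q - 1"
      using step(2) unfolding kappa_step_iff by blast
    have "psum \<delta> n = psum \<gamma> n"
      using pq alt other by (intro sum_two[of _ p q]) auto
    moreover have "bounded_by N n \<delta>"
    proof
      fix j assume "j \<in> {1..n}"
      then have "entry \<gamma> j \<le> N" "entry \<gamma> q \<le> N" using step.IH pq by auto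
      then show "entry \<delta> j \<le> N"
        using alt pq(4) other[of j] by (cases "j = p"; cases "j = q") auto
    qed
    moreover have "\<delta> \<in> agree n \<gamma>"
      using other pq by (auto simp: agree_def)
    moreover have "theta N n \<delta> I \<le> theta N n \<alpha> I" for I
      using step.IH *[of I] le_trans by blast
    ultimately show ?case
      using step.IH by (auto simp: agree_def)
  qed
  then show ?thesis
    using sum_entry_le_theta[of _ n \<beta> N] unfolding keytope_def by (auto intro: le_trans)
qed

section \<open>Symmetry and strings of \<open>keytope\<close> at an ascent\<close>

lemma sum_entry_adj:
  assumes "finite I" "i \<in> I \<longleftrightarrow> Suc i \<in> I"
  shows "(\<Sum>k\<in>I. entry (adj i \<beta>) k) = (\<Sum>k\<in>I. entry \<beta> k)"
proof (cases "i \<in> I")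
  case True
  then show ?thesis
    using assms by (intro sum_two[of I i "Suc i"]) (auto simp: entry_adj)
next
  case False
  then show ?thesis
    using assms by (intro sum.cong) (auto simp: entry_adj)
qed

lemma sum_entry_adj_insert:
  assumes "finite J" "i \<notin> J" "Suc i \<notin> J"
  shows "(\<Sum>k\<in>insert i J. entry (adj i \<beta>) k) = (\<Sum>k\<in>insert (Suc i) J. entry \<beta> k)"
    "(\<Sum>k\<in>insert (Suc i) J. entry (adj i \<beta>) k) = (\<Sum>k\<in>insert i J. entry \<beta> k)"
proof -
  have "(\<Sum>k\<in>J. entry (adj i \<beta>) k) = (\<Sum>k\<in>J. entry \<beta> k)"
    using assms by (intro sum_entry_adj) auto
  then show "(\<Sum>k\<in>insert i J. entry (adj i \<beta>) k) = (\<Sum>k\<in>insert (Suc i) J. entry \<beta> k)"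
    "(\<Sum>k\<in>insert (Suc i) J. entry (adj i \<beta>) k) = (\<Sum>k\<in>insert i J. entry \<beta> k)"
    using assms by (simp_all add: entry_adj)
qed

lemma agree_adj:
  assumes "1 \<le> i" "i < n"
  shows "agree n (adj i \<alpha>) = agree n \<alpha>" "adj i \<beta> \<in> agree n \<alpha> \<longleftrightarrow> \<beta> \<in> agree n \<alpha>"
  using assms by (auto simp: agree_def entry_adj)

lemma psum_adj:
  assumes "1 \<le> i" "i < n"
  shows "psum (adj i \<alpha>) n = psum \<alpha> n"
  using assms by (intro sum_entry_adj) auto

text \<open>At an ascent every column containing \<open>i\<close> also contains
  \<open>i + 1\<close>. Exchanging \<open>i\<close> and \<open>i + 1\<close> in \<open>I\<close>
  then leaves \<open>theta\<close> unchanged, one inequality coming from each of the two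
  monotonicity lemmas for \<open>match_rank\<close>.\<close>

lemma keytope_adj_closed:
  assumes i: "is_ascent n \<alpha> i" and \<beta>: "\<beta> \<in> keytope N n \<alpha>"
  shows "adj i \<beta> \<in> keytope N n \<alpha>"
proof -
  have le: "(\<Sum>k\<in>I. entry \<beta> k) \<le> theta N n \<alpha> I" if "I \<subseteq> {1..n}" for I
    using \<beta> that by (auto simp: keytope_def)
  have in1: "i \<in> {1..n}" "Suc i \<in> {1..n}" using i by (auto simp: is_ascent_iff)
  have "(\<Sum>k\<in>I. entry (adj i \<beta>) k) \<le> theta N n \<alpha> I" if I: "I \<subseteq> {1..n}" for I
  proof -
    define J where "J = I - {i, Suc i}"
    have fin: "finite I" using I finite_subset by blast
    have J: "finite J" "i \<notin> J" "Suc i \<notin> J" "J \<subseteq> {1..n}" using fin I by (auto simp: J_def)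
    consider "i \<in> I \<longleftrightarrow> Suc i \<in> I" | "I = insert i J" | "I = insert (Suc i) J"
      by (auto simp: J_def)
    then show ?thesis
    proof cases
      case 1
      then show ?thesis using le[OF I] sum_entry_adj[OF fin 1] by simp
    next
      case 2
      have "(\<Sum>k\<in>I. entry (adj i \<beta>) k) \<le> theta N n \<alpha> (insert (Suc i) J)"
        unfolding 2 sum_entry_adj_insert(1)[OF J(1-3)] using in1 J by (intro le) auto
      also have "\<dots> \<le> theta N n \<alpha> I"
        unfolding theta_def 2 using J by (intro sum_mono match_rank_insert_left_mono) auto
      finally show ?thesis .
    next
      case 3
      have "(\<Sum>k\<in>I. entry (adj i \<beta>) k) \<le> theta N n \<alpha> (insert i J)"
        unfolding 3 sum_entry_adj_insert(2)[OF J(1-3)] using in1 J by (intro le) auto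
      also have "\<dots> \<le> theta N n \<alpha> I"
        unfolding theta_def 3 using J i
        by (intro sum_mono match_rank_shift_left) (auto simp: level_def is_ascent_iff)
      finally show ?thesis .
    qed
  qed
  then show ?thesis
    using \<beta> i agree_adj[of i n] psum_adj[of i n] by (auto simp: keytope_def is_ascent_iff)
qed

text \<open>The columns that change have \<open>i + 1\<close> replaced by \<open>i\<close>. Passing
  to \<open>adj i \<alpha>\<close> can thus tighten only the constraints for sets with
  \<open>i + 1\<close> but without \<open>i\<close>.\<close>

lemma theta_adj:
  assumes i: "is_ascent n \<alpha> i" and I: "finite I" "i \<in> I \<or> Suc i \<notin> I"
  shows "theta N n \<alpha> I \<le> theta N n (adj i \<alpha>) I"
  unfolding theta_def
proof (rule sum_mono)
  fix c
  have mem: "j \<in> level n \<zeta> c \<longleftrightarrow> 1 \<le> j \<and> j \<le> n \<and> c \<le> entry \<zeta> j" for \<zeta> j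
    by (simp add: level_def)
  show "match_rank I (level n \<alpha> c) \<le> match_rank I (level n (adj i \<alpha>) c)"
  proof (cases "entry \<alpha> i < c \<and> c \<le> entry \<alpha> (Suc i)")
    case True
    define E where "E = level n \<alpha> c - {Suc i}"
    have "level n \<alpha> c = insert (Suc i) E"
      using True i by (auto simp: E_def mem is_ascent_iff)
    moreover have "level n (adj i \<alpha>) c = insert i E"
      using True i by (auto simp: E_def mem is_ascent_iff entry_adj split: if_splits)
    moreover have "i \<notin> E" "Suc i \<notin> E" "finite E"
      using True by (auto simp: E_def mem)
    ultimately show ?thesis
      using match_rank_shift_right[of I E i] I by simp
  next
    case False
    then have "level n (adj i \<alpha>) c = level n \<alpha> c"
      using i by (auto simp: set_eq_iff mem is_ascent_iff entry_adj)
    then show ?thesis by simp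
  qed
qed

lemma theta_mono: "finite J \<Longrightarrow> I \<subseteq> J \<Longrightarrow> theta N n \<alpha> I \<le> theta N n \<alpha> J"
  unfolding theta_def by (intro sum_mono match_rank_mono)

lemma theta_submodular:
  assumes "finite I" "finite J"
  shows "theta N n \<alpha> (I \<union> J) + theta N n \<alpha> (I \<inter> J) \<le> theta N n \<alpha> I + theta N n \<alpha> J"
  unfolding theta_def sum.distrib[symmetric]
  by (intro sum_mono match_rank_submodular_left assms)

text \<open>Sliding \<open>\<beta>\<close> towards \<open>i\<close> by the least amount that meets the constraints for the sets
  containing \<open>i + 1\<close> but not \<open>i\<close>; submodularity shows that the constraints for the sets
  containing \<open>i\<close> but not \<open>i + 1\<close> survive.\<close>

lemma keytope_string_aux:
  assumes i: "is_ascent n \<alpha> i" and \<beta>: "\<beta> \<in> keytope N n \<alpha>" and ge: "entry \<beta> (Suc i) \<le> entry \<beta> i"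
  shows "\<exists>\<gamma>\<in>keytope N n (adj i \<alpha>). on_string i \<gamma> \<beta>"
proof -
  let ?\<theta> = "theta N n \<alpha>" and ?\<theta>' = "theta N n (adj i \<alpha>)"
  let ?s = "\<lambda>I. \<Sum>k\<in>I. entry \<beta> k"
  have in1: "1 \<le> i" "i < n" using i by (auto simp: is_ascent_iff)
  have le: "?s I \<le> ?\<theta> I" if "I \<subseteq> {1..n}" for I
    using \<beta> that by (auto simp: keytope_def)
  have le': "?s I \<le> ?\<theta>' I" if "I \<subseteq> {1..n}" "i \<in> I \<or> Suc i \<notin> I" for I
    using le[OF that(1)] theta_adj[OF i _ that(2)] finite_subset[OF that(1)] le_trans by blast
  define \<J> where "\<J> = {J \<in> Pow {1..n}. Suc i \<in> J \<and> i \<notin> J}"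
  \<comment> \<open>The largest violation among the critical sets; truncated subtraction gives
    \<open>0\<close> when there is none.\<close>
  define k where "k = Max ((\<lambda>J. ?s J - ?\<theta>' J) ` \<J>)"
  have fin\<J>: "finite \<J>" and ne: "\<J> \<noteq> {}"
    using in1 by (auto simp: \<J>_def intro!: exI[of _ "{Suc i}"])
  have k_ge: "?s J - ?\<theta>' J \<le> k" if "J \<in> \<J>" for J
    unfolding k_def using fin\<J> that by (intro Max_ge) auto
  have "k \<in> (\<lambda>J. ?s J - ?\<theta>' J) ` \<J>"
    unfolding k_def using fin\<J> ne by (intro Max_in) auto
  then obtain J where J: "J \<in> \<J>" and k: "k = ?s J - ?\<theta>' J" by auto
  have J': "J \<subseteq> {1..n}" "Suc i \<in> J" "i \<notin> J" "finite J"
    using J finite_subset by (auto simp: \<J>_def)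
  \<comment> \<open>This makes the subtraction of \<open>k\<close> exact. Without
    \<open>i + 1\<close> the extremal set satisfies its constraint, so its excess is at most the
    entry there.\<close>
  have k_le: "k \<le> entry \<beta> (Suc i)"
  proof -
    have "?s (J - {Suc i}) \<le> ?\<theta>' (J - {Suc i})"
      using J' by (intro le') auto
    also have "\<dots> \<le> ?\<theta>' J" using J' by (intro theta_mono) auto
    finally show ?thesis
      using J' by (simp add: k sum.remove[of J "Suc i"])
  qed
  define \<gamma> where "\<gamma> = put i (entry \<beta> i + k) (put (Suc i) (entry \<beta> (Suc i) - k) \<beta>)"
  have ent: "entry \<gamma> j = (if j = i then entry \<beta> i + k else if j = Suc i then entry \<beta> (Suc i) - k
      else entry \<beta> j)" for j
    by (simp add: \<gamma>_def entry_put)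
  have both: "(\<Sum>j\<in>I. entry \<gamma> j) = ?s I" if "i \<in> I \<longleftrightarrow> Suc i \<in> I" "finite I" for I
  proof (cases "i \<in> I")
    case True
    then show ?thesis
      using that k_le by (intro sum_two[of I i "Suc i"]) (auto simp: ent)
  next
    case False
    then show ?thesis using that by (intro sum.cong) (auto simp: ent)
  qed
  have "(\<Sum>j\<in>I. entry \<gamma> j) \<le> ?\<theta>' I" if I: "I \<subseteq> {1..n}" for I
  proof -
    have fin: "finite I" using I finite_subset by blast
    have rest: "(\<Sum>j\<in>I - {i, Suc i}. entry \<gamma> j) = ?s (I - {i, Suc i})"
      using fin by (intro both) auto
    consider "i \<in> I \<longleftrightarrow> Suc i \<in> I" | "i \<notin> I" "Suc i \<in> I" | "i \<in> I" "Suc i \<notin> I" by blast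
    then show ?thesis
    proof cases
      case 1
      then show ?thesis using both[OF 1 fin] le'[OF I] by auto
    next
      case 2
      then have I': "I - {i, Suc i} = I - {Suc i}" by auto
      have "(\<Sum>j\<in>I. entry \<gamma> j) + k = ?s I"
        using rest k_le 2 fin unfolding I' by (simp add: sum.remove[of I "Suc i"] ent)
      moreover have "?s I - ?\<theta>' I \<le> k"
        using 2 I by (intro k_ge) (auto simp: \<J>_def)
      ultimately show ?thesis by linarith
    next
      case 3
      then have I': "I - {i, Suc i} = I - {i}" by auto
      have sum: "(\<Sum>j\<in>I. entry \<gamma> j) = ?s I + k"
        using rest 3 fin unfolding I' by (simp add: sum.remove[of I i] ent)
      show ?thesis
      proof (cases "k = 0")
        case True
        then show ?thesis using sum le'[OF I] 3 by simp
      next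
        case False
        \<comment> \<open>As \<open>k > 0\<close>, the excess of \<open>J\<close> is exactly
          \<open>k\<close>. The union contains \<open>i\<close> and the intersection omits
          \<open>i + 1\<close>, so neither is critical, and submodularity leaves \<open>I\<close>
          with slack at least \<open>k\<close>.\<close>
        have "?s I + ?s J = ?s (I \<union> J) + ?s (I \<inter> J)"
          using fin J' by (simp add: sum.union_inter)
        also have "\<dots> \<le> ?\<theta>' (I \<union> J) + ?\<theta>' (I \<inter> J)"
          using I J' 3 by (intro add_mono le') auto
        also have "\<dots> \<le> ?\<theta>' I + ?\<theta>' J"
          by (rule theta_submodular[OF fin J'(4)])
        finally show ?thesis using sum k False by linarith
      qed
    qed
  qed
  moreover have "psum \<gamma> n = psum \<beta> n"
    using in1 by (intro both) auto
  moreover have "\<gamma> \<in> agree n \<alpha>"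
    using \<beta> in1 by (simp add: agree_def keytope_def ent)
  moreover have "psum \<beta> n = psum \<alpha> n"
    using \<beta> by (simp add: keytope_def)
  ultimately have "\<gamma> \<in> keytope N n (adj i \<alpha>)"
    unfolding keytope_def agree_adj[OF in1] psum_adj[OF in1] by simp
  moreover have "on_string i \<gamma> \<beta>"
    using k_le ge by (auto simp: on_string_def ent)
  ultimately show ?thesis by blast
qed

text \<open>Both \<open>keytope\<close> and the string are invariant under \<open>adj i\<close>, so
  it suffices to treat the half where the entry at \<open>i\<close> is the larger one.\<close>

lemma keytope_string:
  assumes i: "is_ascent n \<alpha> i" and \<beta>: "\<beta> \<in> keytope N n \<alpha>"
  shows "\<exists>\<gamma>\<in>keytope N n (adj i \<alpha>). on_string i \<gamma> \<beta>"
proof (cases "entry \<beta> (Suc i) \<le> entry \<beta> i")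
  case True
  then show ?thesis using keytope_string_aux assms by blast
next
  case False
  then have "\<exists>\<gamma>\<in>keytope N n (adj i \<alpha>). on_string i \<gamma> (adj i \<beta>)"
    using keytope_string_aux[OF i keytope_adj_closed[OF i \<beta>]] by (simp add: entry_adj)
  then show ?thesis by simp
qed

text \<open>Two families of sets give all the inequalities of \<open>strip\<close>: complements of
  single points give the lower bounds on entries, initial segments the bounds on partial
  sums.\<close>

lemma keytope_expansion:
  assumes wd: "weakly_decreasing b \<alpha>" and N: "bounded_by N (Suc b) \<alpha>"
    and \<beta>: "\<beta> \<in> keytope N (Suc b) \<alpha>"
  shows "\<beta> \<in> expansion b \<alpha>"
proof -
  let ?n = "Suc b"
  have mem: "j \<in> level ?n \<alpha> c \<longleftrightarrow> 1 \<le> j \<and> j \<le> ?n \<and> c \<le> entry \<alpha> j" for j c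
    by (simp add: level_def)
  have le: "(\<Sum>k\<in>I. entry \<beta> k) \<le> theta N ?n \<alpha> I" if "I \<subseteq> {1..?n}" for I
    using \<beta> that by (auto simp: keytope_def)
  have total: "psum \<beta> ?n = psum \<alpha> ?n" using \<beta> by (simp add: keytope_def)
  have initial: "{1..j} \<subseteq> level ?n \<alpha> c" if "j \<le> b" "j \<in> level ?n \<alpha> c" for j c
    using that weakly_decreasingD[OF wd] by (force simp: mem)
  have "entry \<alpha> j \<le> entry \<beta> j" if j: "1 \<le> j" "j \<le> b" for j
  proof -
    let ?I = "{1..?n} - {j}"
    have "theta N ?n \<alpha> ?I \<le> (\<Sum>c=1..N. card (?I \<inter> level ?n \<alpha> c))"
      unfolding theta_def
    proof (rule sum_mono)
      fix c
      let ?D = "level ?n \<alpha> c"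
      have D: "?I \<inter> ?D = ?D - {j}" by (auto simp: level_def)
      show "match_rank ?I ?D \<le> card (?I \<inter> ?D)"
      proof (cases "j \<in> ?D")
        case False
        then have "?D - {j} = ?D" by simp
        then show ?thesis using match_rank_le[of ?I ?D 0] unfolding D by simp
      next
        case True
        \<comment> \<open>A column containing \<open>j\<close> contains all of
          \<open>{1..j}\<close>, so the cut after \<open>j\<close> counts exactly the column without
          \<open>j\<close>.\<close>
        have "c \<le> entry \<alpha> k" if "1 \<le> k" "k \<le> j" for k
          using initial[OF j(2) True] that by (auto simp: level_def)
        then have "?D - {j} = (?I \<inter> {..<Suc j}) \<union> (?D \<inter> {Suc j..})"
          using j by (auto simp: mem)
        then have "card (?D - {j}) = card (?I \<inter> {..<Suc j}) + card (?D \<inter> {Suc j..})"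
          by (simp add: card_Un_disjoint disjoint_iff)
        then show ?thesis using match_rank_le[of ?I ?D "Suc j"] unfolding D by simp
      qed
    qed
    also have "\<dots> = (\<Sum>k\<in>?I. entry \<alpha> k)"
      using N by (intro sum_card_level) auto
    finally have "(\<Sum>k\<in>?I. entry \<beta> k) \<le> (\<Sum>k\<in>?I. entry \<alpha> k)"
      using le[of ?I] by auto
    moreover have "psum \<zeta> ?n = entry \<zeta> j + (\<Sum>k\<in>?I. entry \<zeta> k)" for \<zeta>
      using j sum.remove[of "{1..?n}" j "entry \<zeta>"] by simp
    ultimately show ?thesis using total by simp
  qed
  moreover have "psum \<beta> j \<le> psum \<alpha> j + (entry \<alpha> ?n - entry \<alpha> j)" if j: "1 \<le> j" "j \<le> b" for j
  proof -
    let ?I = "{1..j}"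
    \<comment> \<open>The columns that contain the last position but not \<open>j\<close>. Each adds
      at most one to the rank of \<open>{1..j}\<close>, and there are at most as many as the
      truncated difference of the two entries.\<close>
    let ?C = "{c \<in> {1..N}. entry \<alpha> j < c \<and> c \<le> entry \<alpha> ?n}"
    have "theta N ?n \<alpha> ?I \<le> (\<Sum>c=1..N. card (?I \<inter> level ?n \<alpha> c) + (if c \<in> ?C then 1 else 0))"
      unfolding theta_def
    proof (rule sum_mono)
      fix c assume c: "c \<in> {1..N}"
      let ?D = "level ?n \<alpha> c"
      show "match_rank ?I ?D \<le> card (?I \<inter> ?D) + (if c \<in> ?C then 1 else 0)"
      proof (cases "j \<in> ?D")
        case True
        then have "?I \<inter> ?D = ?I" using initial[OF j(2)] by auto
        moreover have "?I \<inter> {..<Suc ?n} = ?I" "?D \<inter> {Suc ?n..} = {}" using j by (auto simp: mem)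
        ultimately show ?thesis using match_rank_le[of ?I ?D "Suc ?n"] by simp
      next
        case False
        have lt: "entry \<alpha> j < c" using False j by (simp add: mem)
        have "k < j \<or> k = ?n" if "k \<in> ?D" for k
          using that lt weakly_decreasingD[OF wd j(1), of k] by (fastforce simp: mem)
        then have "?D \<subseteq> (?I \<inter> ?D) \<union> (if ?n \<in> ?D then {?n} else {})"
          by (fastforce simp: mem)
        then have "card ?D \<le> card ((?I \<inter> ?D) \<union> (if ?n \<in> ?D then {?n} else {}))"
          by (intro card_mono) auto
        also have "\<dots> \<le> card (?I \<inter> ?D) + card (if ?n \<in> ?D then {?n} else {})"
          by (rule card_Un_le)
        also have "card (if ?n \<in> ?D then {?n} else {}) = (if c \<in> ?C then 1 else 0)"
          using c lt by (simp add: mem)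
        finally show ?thesis using match_rank_le[of ?I ?D 0] by simp
      qed
    qed
    also have "\<dots> = psum \<alpha> j + card ?C"
      using j N sum_card_level[of ?I ?n \<alpha> N] by (simp add: sum.distrib sum.If_cases Int_def)
    also have "card ?C \<le> card {entry \<alpha> j<..entry \<alpha> ?n}"
      by (intro card_mono) auto
    finally show ?thesis using le[of ?I] j by auto
  qed
  ultimately show ?thesis
    using \<beta> by (simp add: expansion_def strip_def keytope_def)
qed

text \<open>By positivity the support of the sum is the union of the supports of its summands. In
  each summand a string stays inside the order ideal, which is the full support by the assumption
  \<open>keys\<close> in \<open>n\<close> variables.\<close>

lemma keys_keysum_closed:
  assumes "keysum n Q f" "1 \<le> i" "i < n"
    and keys: "\<And>\<nu> \<beta>. kappa_le n \<beta> \<nu> \<Longrightarrow> \<beta> \<in> Poly_Mapping.keys (key_poly n \<nu>)"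
    and "\<gamma> \<in> Poly_Mapping.keys f" "on_string i \<gamma> \<beta>"
  shows "\<beta> \<in> Poly_Mapping.keys (demazure i f)"
  using assms(1,5)
proof (induction rule: keysum.induct)
  case zero
  then show ?case by simp
next
  case (add \<nu> f)
  have nonneg: "0 \<le> coef (key_poly n (raise i \<nu>)) \<beta>" "0 \<le> coef (demazure i f) \<beta>"
    using coef_key_poly_nonneg coef_keysum_nonneg keysum_demazure[OF add(2) assms(2,3), of "\<lambda>_. True"]
    by auto
  consider "\<gamma> \<in> Poly_Mapping.keys (key_poly n \<nu>)" | "\<gamma> \<in> Poly_Mapping.keys f"
    using add.prems Poly_Mapping.keys_add[of "key_poly n \<nu>" f] by auto
  then have "\<beta> \<in> Poly_Mapping.keys (key_poly n (raise i \<nu>)) \<or> \<beta> \<in> Poly_Mapping.keys (demazure i f)"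
  proof cases
    case 1
    then have "kappa_le n \<beta> (raise i \<nu>)"
      using kappa_le_string_closed[OF assms(2,3) _ assms(6)] keys_key_poly_kappa_le by simp
    then show ?thesis using keys by simp
  next
    case 2
    then show ?thesis using add.IH by simp
  qed
  then show ?case
    using nonneg assms(2,3)
    by (auto simp: demazure_add demazure_key_poly in_keys_iff lookup_add)
qed

text \<open>An outer induction on the number of variables supplies the supports needed after
  branching. The inner one runs over ascents \<open>i < b\<close>, starting from the explicit
  expansion and lifting along strings.\<close>

lemma keytope_subset_keys:
  assumes "bounded_by N n \<alpha>" "\<beta> \<in> keytope N n \<alpha>"
  shows "\<beta> \<in> Poly_Mapping.keys (key_poly n \<alpha>)"
  using assms
proof (induction n arbitrary: N \<alpha> \<beta>)
  case 0
  then have "\<beta> = \<alpha>" by (auto simp: keytope_def agree_0)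
  then show ?case by (simp add: key_poly_dominant weakly_decreasing_def monomial_def)
next
  case (Suc b)
  have keys: "\<beta> \<in> Poly_Mapping.keys (key_poly b \<nu>)" if "kappa_le b \<beta> \<nu>" for \<nu> \<beta>
  proof -
    \<comment> \<open>The induction hypothesis holds for every bound, so a crude one for
      \<open>\<nu>\<close> suffices.\<close>
    have "bounded_by (\<Sum>k=1..b. entry \<nu> k) b \<nu>"
      by (auto intro: member_le_sum)
    then show ?thesis using Suc.IH kappa_le_keytope that by blast
  qed
  show ?case
    using Suc.prems
  proof (induction \<alpha> arbitrary: \<beta> rule: key_poly_induct[where n = b])
    case (dominant \<alpha>)
    then show ?case
      using keytope_expansion by (simp add: key_poly_expansion keys_polyset finite_expansion)
  next
    case (ascent \<alpha> i)
    have i: "is_ascent (Suc b) \<alpha> i" "1 \<le> i" "i < b"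
      using ascent.hyps by (auto simp: is_ascent_iff)
    obtain \<gamma> where \<gamma>: "\<gamma> \<in> keytope N (Suc b) (adj i \<alpha>)" "on_string i \<gamma> \<beta>"
      using keytope_string[OF i(1) ascent.prems(2)] by blast
    have "bounded_by N (Suc b) (adj i \<alpha>)"
      using ascent.prems(1) i by (auto simp: entry_adj)
    then have "\<gamma> \<in> Poly_Mapping.keys (key_poly (Suc b) (adj i \<alpha>))"
      using ascent.IH(2) \<gamma>(1) by blast
    then show ?case
      unfolding key_poly_ascent[OF i(1)]
      using keys_keysum_closed[OF key_poly_branch i(2,3) keys _ \<gamma>(2)] by blast
  qed
qed

section \<open>From supports to the Newton polytope\<close>

lemma lookup_scaleR: "Poly_Mapping.lookup (r *\<^sub>R v) k = r *\<^sub>R Poly_Mapping.lookup v k"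
  by (simp add: scaleR_poly_mapping_def)

theorem theorem1p1:
  fixes n :: nat and \<alpha> \<beta> :: "nat \<Rightarrow>\<^sub>0 nat"
  assumes "n \<ge> 1" and "composition n \<alpha>" and "composition n \<beta>"
  shows "(lattice_point (real_vec \<beta>) \<and> real_vec \<beta> \<in> newton (key_poly n \<alpha>) \<longleftrightarrow> kappa_le n \<beta> \<alpha>)
    \<and> (\<beta> \<in> Poly_Mapping.keys (key_poly n \<alpha>) \<longleftrightarrow> kappa_le n \<beta> \<alpha>)"
proof -
  define N where "N = psum \<alpha> n"
  have N: "bounded_by N n \<alpha>"
    unfolding N_def by (auto intro: member_le_sum)
  have keys_iff: "\<gamma> \<in> Poly_Mapping.keys (key_poly n \<alpha>) \<longleftrightarrow> kappa_le n \<gamma> \<alpha>" for \<gamma>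
    using keys_key_poly_kappa_le kappa_le_keytope[OF _ N] keytope_subset_keys[OF N] by blast
  have lookup_real_vec: "Poly_Mapping.lookup (real_vec \<gamma>) k = real (entry \<gamma> k)" for \<gamma> k
    by (simp add: real_vec_def map.rep_eq when_def)
  \<comment> \<open>Half-spaces; the factor \<open>s\<close> will be \<open>1\<close> or
    \<open>- 1\<close>, so that both directions of an inequality are covered.\<close>
  define H where "H s I c = {v. s * (\<Sum>k\<in>I. Poly_Mapping.lookup v k) \<le> c}"
    for s c :: real and I :: "nat set"
  have convex_H: "convex (H s I c)" for s I c
  proof (rule convexI)
    fix v w :: "nat \<Rightarrow>\<^sub>0 real" and p q :: real
    assume *: "v \<in> H s I c" "w \<in> H s I c" "0 \<le> p" "0 \<le> q" "p + q = 1"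
    have "s * (\<Sum>k\<in>I. Poly_Mapping.lookup (p *\<^sub>R v + q *\<^sub>R w) k)
        = p * (s * (\<Sum>k\<in>I. Poly_Mapping.lookup v k)) + q * (s * (\<Sum>k\<in>I. Poly_Mapping.lookup w k))"
      by (simp add: lookup_add lookup_scaleR sum.distrib sum_distrib_left algebra_simps)
    also have "\<dots> \<le> p * c + q * c"
      using * by (intro add_mono mult_left_mono) (auto simp: H_def)
    also have "\<dots> = c" using *(5) by (metis distrib_right mult_1)
    finally show "p *\<^sub>R v + q *\<^sub>R w \<in> H s I c" by (simp add: H_def)
  qed
  have "kappa_le n \<beta> \<alpha>" if \<beta>: "real_vec \<beta> \<in> newton (key_poly n \<alpha>)"
  proof -
    \<comment> \<open>A linear inequality valid on \<open>keytope\<close> holds on the exponent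
      vectors, hence on their convex hull.\<close>
    have hull: "s * real (\<Sum>k\<in>I. entry \<beta> k) \<le> c"
      if "\<And>\<gamma>. \<gamma> \<in> keytope N n \<alpha> \<Longrightarrow> s * real (\<Sum>k\<in>I. entry \<gamma> k) \<le> c" for s I c
    proof -
      have "newton (key_poly n \<alpha>) \<subseteq> H s I c"
        unfolding newton_def using that kappa_le_keytope[OF _ N]
        by (intro hull_minimal convex_H) (auto simp: keys_iff H_def lookup_real_vec)
      then show ?thesis using \<beta> by (auto simp: H_def lookup_real_vec)
    qed
    have "(\<Sum>k\<in>I. entry \<beta> k) \<le> theta N n \<alpha> I" if "I \<subseteq> {1..n}" for I
    proof -
      have "1 * real (\<Sum>k\<in>I. entry \<beta> k) \<le> real (theta N n \<alpha> I)"
        using that by (intro hull) (simp add: keytope_def del: of_nat_sum)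
      then show ?thesis by linarith
    qed
    moreover have "1 * real (psum \<beta> n) \<le> real (psum \<alpha> n)"
      by (rule hull) (simp add: keytope_def del: of_nat_sum)
    \<comment> \<open>Together with the preceding inequality this fixes the total degree.\<close>
    moreover have "- 1 * real (psum \<beta> n) \<le> - real (psum \<alpha> n)"
      by (rule hull) (simp add: keytope_def del: of_nat_sum)
    moreover have "\<beta> \<in> agree n \<alpha>"
    proof -
      have "entry \<gamma> j = 0" if "composition n \<gamma>" "j = 0 \<or> n < j" for \<gamma> j
        using that by (auto simp: composition_def subset_iff in_keys_iff)
      then show ?thesis using assms by (simp add: agree_def)
    qed
    ultimately have "\<beta> \<in> keytope N n \<alpha>"
      by (simp add: keytope_def del: of_nat_sum)
    then show ?thesis using keytope_subset_keys[OF N] keys_iff by blast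
  qed
  moreover have "lattice_point (real_vec \<beta>)"
    by (simp add: lattice_point_def lookup_real_vec)
  moreover have "real_vec \<beta> \<in> newton (key_poly n \<alpha>)" if "kappa_le n \<beta> \<alpha>"
    unfolding newton_def using that by (intro hull_inc) (simp add: keys_iff)
  ultimately show ?thesis using keys_iff by blast
qed

end
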